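(* Let $\mathcal{A}$ be a unital JB-algebra with unit $I$ and let $A, B$ be two positive invertible elements of $\mathcal{A}$. Then for any $0<\lambda<1$, $$A\#_{\lambda}B=\frac{\sin(\lambda\pi)}{\pi}\int_0^{\infty} t^{\lambda-1}\left(A^{-1}+tB^{-1}\right)^{-1}dt=\frac{\sin(\lambda\pi)}{\pi}\int_0^1\frac{t^{\lambda-1}}{(1-t)^{\lambda}}\,(A!_tB)\,dt .$$
   Context: A Jordan algebra over $\mathbb{R}$ is a real vector space with a bilinear product $\circ$ satisfying $a\circ b=b\circ a$ and $(a^2\circ b)\circ a=a^2\circ(b\circ a)$. A JB-algebra is a Jordan algebra over $\mathbb{R}$ with a complete norm satisfying $\|A\circ B\|\le\|A\|\|B\|$, $\|A^2\|=\|A\|^2$ and $\|A^2\|\le\|A^2+B^2\|$. In a unital JB-algebra $\mathcal{A}$ with unit $I$: $A$ is invertible, with Jordan inverse $A^{-1}=B$, if $A\circ B=I$ and $A^2\circ B=A$; the spectrum is $\mathrm{Sp}(A)=\{\lambda\in\mathbb{R}: A-\lambda I \text{ is not invertible}\}$; $A$ is positive ($A\ge 0$) if $\mathrm{Sp}(A)\subset[0,\infty)$; $A\le B$ means $B-A\ge0$. For $f$ continuous on $\mathrm{Sp}(A)$, $f(A)$ is defined by the continuous functional calculus in the norm-closed (associative) JB-subalgebra generated by $A$ and $I$, which is isometrically isomorphic to $C(\mathrm{Sp}(A))$. The Jordan triple notation is $\{ABA\}:=2(A\circ B)\circ A-A^2\circ B$. For positive invertible $A,B\in\mathcal{A}$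 and $0\le\lambda\le1$: the weighted geometric mean is $A\#_\lambda B=\{A^{1/2}\{A^{-1/2}BA^{-1/2}\}^{\lambda}A^{1/2}\}$, and the weighted harmonic mean is $A!_\lambda B=((1-\lambda)A^{-1}+\lambda B^{-1})^{-1}$. The integrals are (improper) Riemann integrals of $\mathcal{A}$-valued functions, converging in norm. *)

theory Defs
  imports "HOL-Analysis.Analysis"
begin

class jordan_algebra = real_vector +
  fixes jprod :: "'a \<Rightarrow> 'a \<Rightarrow> 'a"  (infixl "\<odot>" 70)
  assumes jprod_commute: "a \<odot> b = b \<odot> a"
    and jprod_add_left: "(a + b) \<odot> c = a \<odot> c + b \<odot> c"
    and jprod_scaleR_left: "scaleR r a \<odot> b = scaleR r (a \<odot> b)"
    and jordan_identity: "((a \<odot> a) \<odot> b) \<odot> a = (a \<odot> a) \<odot> (b \<odot> a)"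

class jb_algebra = jordan_algebra + banach +
  assumes norm_jprod_le: "norm (a \<odot> b) \<le> norm a * norm b"
    and norm_jsquare: "norm (a \<odot> a) = (norm a)\<^sup>2"
    and norm_jsquare_le_add: "norm (a \<odot> a) \<le> norm (a \<odot> a + b \<odot> b)"

text \<open>The zero algebra (\<open>1 = 0\<close>) is not excluded.\<close>

class unital_jb_algebra = jb_algebra + one +
  assumes jprod_one_left: "1 \<odot> a = a"

definition is_jinverse :: "'a::unital_jb_algebra \<Rightarrow> 'a \<Rightarrow> bool" where
  "is_jinverse a b \<longleftrightarrow> a \<odot> b = 1 \<and> (a \<odot> a) \<odot> b = a"

definition jinvertible :: "'a::unital_jb_algebra \<Rightarrow> bool" where
  "jinvertible a \<longleftrightarrow> (\<exists>b. is_jinverse a b)"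

text \<open>The Jordan inverse is unique when it exists; for a non-invertible element
  the value of \<open>jinv\<close> is unspecified.\<close>

definition jinv :: "'a::unital_jb_algebra \<Rightarrow> 'a" where
  "jinv a = (THE b. is_jinverse a b)"

definition jspectrum :: "'a::unital_jb_algebra \<Rightarrow> real set" where
  "jspectrum a = {r. \<not> jinvertible (a - r *\<^sub>R 1)}"

definition jpositive :: "'a::unital_jb_algebra \<Rightarrow> bool" where
  "jpositive a \<longleftrightarrow> jspectrum a \<subseteq> {0..}"

definition jtriple :: "'a::jordan_algebra \<Rightarrow> 'a \<Rightarrow> 'a" where
  "jtriple a b = 2 *\<^sub>R ((a \<odot> b) \<odot> a) - (a \<odot> a) \<odot> b"

definition jb_generated :: "'a::unital_jb_algebra \<Rightarrow> 'a set" where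
  "jb_generated a =
     (\<lambda>S. subspace S \<and> closed S \<and> (\<forall>x\<in>S. \<forall>y\<in>S. x \<odot> y \<in> S)) hull {1, a}"

text \<open>The inserted \<open>0\<close> only matters for \<open>S = {}\<close>, i.e. for the spectrum in the zero algebra.\<close>

definition sup_norm_on :: "real set \<Rightarrow> (real \<Rightarrow> real) \<Rightarrow> real" where
  "sup_norm_on S f = Sup (insert 0 ((\<lambda>x. \<bar>f x\<bar>) ` S))"

text \<open>\<open>is_functional_calculus a \<Phi>\<close>: restricted to the functions continuous on the spectrum
  of \<open>a\<close>, \<open>\<Phi>\<close> is the unital isometric isomorphism from \<open>C(Sp a)\<close> onto the closed subalgebra
  generated by \<open>a\<close> and \<open>1\<close> that sends the coordinate function to \<open>a\<close>. Elements of
  \<open>C(Sp a)\<close> are represented by total functions; by isometry, \<open>\<Phi>\<close> only depends on their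
  values on the spectrum.\<close>

definition is_functional_calculus ::
    "'a::unital_jb_algebra \<Rightarrow> ((real \<Rightarrow> real) \<Rightarrow> 'a) \<Rightarrow> bool" where
  "is_functional_calculus a \<Phi> \<longleftrightarrow>
     (let C = {f. continuous_on (jspectrum a) f} in
        (\<forall>f\<in>C. \<forall>g\<in>C. \<Phi> (\<lambda>x. f x + g x) = \<Phi> f + \<Phi> g)
      \<and> (\<forall>f\<in>C. \<forall>r. \<Phi> (\<lambda>x. r * f x) = r *\<^sub>R \<Phi> f)
      \<and> (\<forall>f\<in>C. \<forall>g\<in>C. \<Phi> (\<lambda>x. f x * g x) = \<Phi> f \<odot> \<Phi> g)
      \<and> \<Phi> (\<lambda>x. 1) = 1
      \<and> \<Phi> (\<lambda>x. x) = a
      \<and> (\<forall>f\<in>C. norm (\<Phi> f) = sup_norm_on (jspectrum a) f)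
      \<and> \<Phi> ` C = jb_generated a)"

text \<open>Intended for \<open>f\<close> continuous on \<open>jspectrum a\<close>, where all functional calculi for \<open>a\<close> agree.\<close>

definition jcfc :: "(real \<Rightarrow> real) \<Rightarrow> 'a::unital_jb_algebra \<Rightarrow> 'a" where
  "jcfc f a = (THE x. \<exists>\<Phi>. is_functional_calculus a \<Phi> \<and> x = \<Phi> f)"

definition jpowr :: "'a::unital_jb_algebra \<Rightarrow> real \<Rightarrow> 'a" where
  "jpowr a r = jcfc (\<lambda>x. x powr r) a"

definition geometric_mean :: "real \<Rightarrow> 'a::unital_jb_algebra \<Rightarrow> 'a \<Rightarrow> 'a" where
  "geometric_mean l a b =
     jtriple (jpowr a (1/2)) (jpowr (jtriple (jpowr a (- 1/2)) b) l)"

definition harmonic_mean :: "real \<Rightarrow> 'a::unital_jb_algebra \<Rightarrow> 'a \<Rightarrow> 'a" where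
  "harmonic_mean l a b = jinv ((1 - l) *\<^sub>R jinv a + l *\<^sub>R jinv b)"

text \<open>The norm-convergent Riemann integral. It is \<open>has_integral\<close> on a compact interval with the
  gauges restricted to those of constant radius \<open>d\<close>, so that \<open>2 * d\<close> bounds the mesh.\<close>

definition has_riemann_integral ::
    "(real \<Rightarrow> 'a::real_normed_vector) \<Rightarrow> 'a \<Rightarrow> real \<Rightarrow> real \<Rightarrow> bool" where
  "has_riemann_integral f y u v \<longleftrightarrow>
     (\<forall>e>0. \<exists>d>0. \<forall>D. D tagged_division_of {u..v} \<and> (\<lambda>x. ball x d) fine D \<longrightarrow>
        norm ((\<Sum>(x,k)\<in>D. measure lborel k *\<^sub>R f x) - y) < e)"

text \<open>Improper integral over an open interval \<open>S\<close>, where \<open>F\<close> and \<open>G\<close> are the filters of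
  approach to its lower and upper endpoint; the two endpoints are approached independently.\<close>

definition has_improper_integral ::
    "(real \<Rightarrow> 'a::real_normed_vector) \<Rightarrow> 'a \<Rightarrow> real set \<Rightarrow> real filter \<Rightarrow> real filter \<Rightarrow> bool" where
  "has_improper_integral f y S F G \<longleftrightarrow>
     (\<exists>J. (\<forall>u\<in>S. \<forall>v\<in>S. u \<le> v \<longrightarrow> has_riemann_integral f (J u v) u v)
        \<and> ((\<lambda>(u, v). J u v) \<longlongrightarrow> y) (F \<times>\<^sub>F G))"

definition has_integral_0_inf :: "(real \<Rightarrow> 'a::real_normed_vector) \<Rightarrow> 'a \<Rightarrow> bool" where
  "has_integral_0_inf f y \<longleftrightarrow> has_improper_integral f y {0<..} (at_right 0) at_top"

definition has_integral_0_1 :: "(real \<Rightarrow> 'a::real_normed_vector) \<Rightarrow> 'a \<Rightarrow> bool" where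
  "has_integral_0_1 f y \<longleftrightarrow> has_improper_integral f y {0<..<1} (at_right 0) (at_left 1)"

end

theory Submission
  imports Defs "HOL-Computational_Algebra.Fundamental_Theorem_Algebra" "HOL-Real_Asymp.Real_Asymp"
begin

text \<open>Put \<open>T x = {A\<^sup>1\<^sup>/\<^sup>2 x A\<^sup>1\<^sup>/\<^sup>2}\<close> and \<open>C = {A\<^sup>-\<^sup>1\<^sup>/\<^sup>2 B A\<^sup>-\<^sup>1\<^sup>/\<^sup>2}\<close>. The fundamental formula
  \<open>{{x y x} z {x y x}} = {x {y {x z x} y} x}\<close> gives \<open>{x y x}\<^sup>-\<^sup>1 = {x\<^sup>-\<^sup>1 y\<^sup>-\<^sup>1 x\<^sup>-\<^sup>1}\<close>, so that
  \<open>(\<alpha> A\<^sup>-\<^sup>1 + \<beta> B\<^sup>-\<^sup>1)\<^sup>-\<^sup>1 = T ((\<alpha> + \<beta> C\<^sup>-\<^sup>1)\<^sup>-\<^sup>1)\<close>, a function of \<open>C\<close> alone followed by a bounded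
  linear map. Both integrals thereby reduce, uniformly for \<open>x\<close> in the spectrum of \<open>C\<close>, to
  \<open>\<integral> t^(l-1) x / (x + t) dt = x^l \<integral> s^(l-1) (1-s)^(-l) ds\<close> with \<open>s = t / (x + t)\<close>, a Beta integral.\<close>

section \<open>Jordan algebra identities\<close>

text \<open>The notions are bare definitions: \<open>jcfc\<close> is a definite description, and the
  spectrum refers to invertibility in the whole algebra. So the isometry between C(Sp A) and the
  closed subalgebra generated by A must be constructed before any power of A can be computed with.
  The crux is that the norm of p(A) is the maximum of |p| on the spectrum. Over the reals no
  holomorphic resolvent is at hand, and an inverse of A - r is not known in advance to lie in the
  closed subalgebra. Instead, a polynomial without zeros on the spectrum is shown to act on the
  subalgebra by multiplication with a positive lower bound. This is played off against norm (Y^n (1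
  - Y)) = O(1/n) for a square Y of norm 1, a consequence of the positivity of squares.
  Non-associativity is tamed in two ways: functions of one element operator-commute, and A and B
  interact only through the operators U_x = \<open>jtriple x\<close>, for which the fundamental
  formula reads U_{U_x y} = U_x U_y U_x.\<close>

lemma linear_functionals_separate:
  fixes x y :: "'a::real_vector"
  assumes "\<And>f :: 'a \<Rightarrow> real. linear f \<Longrightarrow> f x = f y"
  shows "x = y"
proof (rule ccontr)
  assume "x \<noteq> y"
  then have "independent {x - y}"
    by simp
  then obtain g :: "'a \<Rightarrow> real" where "linear g" "\<forall>z\<in>{x - y}. g z = 1"
    using linear_independent_extend[of "{x - y}" "\<lambda>_. 1"] by auto
  then have "g x - g y = 1"
    by (simp add: linear_diff[symmetric])
  with assms[OF \<open>linear g\<close>] show False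
    by simp
qed

lemma jprod_add_right: "a \<odot> (b + c) = a \<odot> b + a \<odot> (c::'a::jordan_algebra)"
  by (metis jprod_commute jprod_add_left)

lemma jprod_scaleR_right: "a \<odot> scaleR r b = scaleR r (a \<odot> (b::'a::jordan_algebra))"
  by (metis jprod_commute jprod_scaleR_left)

lemma linear_jprod_left: "linear (\<lambda>a. a \<odot> (b::'a::jordan_algebra))"
  by (rule linearI) (auto simp: jprod_add_left jprod_scaleR_left)

lemma linear_jprod_right: "linear (\<lambda>b. a \<odot> (b::'a::jordan_algebra))"
  by (rule linearI) (auto simp: jprod_add_right jprod_scaleR_right)

lemmas jprod_linear =
  jprod_add_left jprod_add_right jprod_scaleR_left jprod_scaleR_right
  linear_diff[OF linear_jprod_left] linear_diff[OF linear_jprod_right]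
  linear_neg[OF linear_jprod_left] linear_neg[OF linear_jprod_right]
  linear_0[OF linear_jprod_left] linear_0[OF linear_jprod_right]

lemmas linear_functional_simps = linear_add linear_diff linear_scale linear_neg linear_0

text \<open>Full polarization of \<open>jordan_identity\<close>, which is cubic in the repeated
  variable: inclusion-exclusion over \<open>a\<close>, \<open>b\<close>, \<open>d\<close> and their
  sums isolates the part that is linear in each of the three.\<close>

lemma jordan_identity_linearized:
  fixes a b c d :: "'a::jordan_algebra"
  shows "((a \<odot> b) \<odot> c) \<odot> d + ((b \<odot> d) \<odot> c) \<odot> a + ((d \<odot> a) \<odot> c) \<odot> b
    = (a \<odot> b) \<odot> (c \<odot> d) + (b \<odot> d) \<odot> (c \<odot> a) + (d \<odot> a) \<odot> (c \<odot> b)"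
\<comment> \<open>Under a real functional each product becomes a real atom, so the vector identity
  is a matter of linear arithmetic, which finds the coefficients of the combination. The next
  identities are proved in the same way.\<close>
proof (rule linear_functionals_separate)
  fix f :: "'a \<Rightarrow> real" assume f: "linear f"
  have J: "f (((x \<odot> x) \<odot> c) \<odot> x) = f ((x \<odot> x) \<odot> (c \<odot> x))" for x
    by (simp add: jordan_identity)
  show "f (((a \<odot> b) \<odot> c) \<odot> d + ((b \<odot> d) \<odot> c) \<odot> a + ((d \<odot> a) \<odot> c) \<odot> b)
    = f ((a \<odot> b) \<odot> (c \<odot> d) + (b \<odot> d) \<odot> (c \<odot> a) + (d \<odot> a) \<odot> (c \<odot> b))"
    using J[of a] J[of b] J[of d] J[of "a + b"] J[of "b + d"] J[of "a + d"] J[of "a + b + d"]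
    unfolding jprod_linear linear_functional_simps[OF f]
    by (simp only: jprod_commute)
qed

text \<open>Polarization of \<open>jtriple\<close> in its outer argument. The proof of the
  fundamental formula needs independent outer entries.\<close>

definition triple :: "'a::jordan_algebra \<Rightarrow> 'a \<Rightarrow> 'a \<Rightarrow> 'a" where
  "triple a b c = (a \<odot> b) \<odot> c + (b \<odot> c) \<odot> a - (a \<odot> c) \<odot> b"

lemma triple_same: "triple a b a = jtriple a b"
  unfolding triple_def jtriple_def by (simp add: jprod_commute scaleR_2)

lemma triple_commute: "triple a b c = triple c b a"
  unfolding triple_def by (simp add: jprod_commute)

lemma triple_linear:
  "triple (a + a') b c = triple a b c + triple a' b c"
  "triple a (b + b') c = triple a b c + triple a b' c"
  "triple a b (c + c') = triple a b c + triple a b c'"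
  "triple (a - a') b c = triple a b c - triple a' b c"
  "triple a (b - b') c = triple a b c - triple a b' c"
  "triple a b (c - c') = triple a b c - triple a b c'"
  unfolding triple_def by (simp_all add: jprod_linear algebra_simps)

lemma triple_jprod:
  "c \<odot> triple x y z = triple (c \<odot> x) y z - triple x (c \<odot> y) z + triple x y (c \<odot> z)"
proof (rule linear_functionals_separate)
  fix f :: "'a \<Rightarrow> real" assume f: "linear f"
  note J = jordan_identity_linearized[THEN arg_cong[where f = f]]
  show "f (c \<odot> triple x y z) = f (triple (c \<odot> x) y z - triple x (c \<odot> y) z + triple x y (c \<odot> z))"
    using J[of c x y z] J[of c x z y] J[of c y x z]
    unfolding triple_def jprod_linear linear_functional_simps[OF f]
    by (simp only: jprod_commute)
qed

text \<open>Exchanging \<open>a\<close> and \<open>b\<close> in the linearized identity for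
  \<open>x\<close>, \<open>y\<close> leaves its right side unchanged; the difference of the two left
  sides is the derivation rule.\<close>

lemma commutator_derivation:
  fixes a b x y :: "'a::jordan_algebra"
  defines "D \<equiv> \<lambda>x. a \<odot> (b \<odot> x) - b \<odot> (a \<odot> x)"
  shows "D (x \<odot> y) = D x \<odot> y + x \<odot> D y"
proof (rule linear_functionals_separate)
  fix f :: "'a \<Rightarrow> real" assume f: "linear f"
  note J = jordan_identity_linearized[THEN arg_cong[where f = f]]
  show "f (D (x \<odot> y)) = f (D x \<odot> y + x \<odot> D y)"
    using J[of x y a b] J[of x y b a]
    unfolding D_def jprod_linear linear_functional_simps[OF f]
    by (simp only: jprod_commute)
qed

text \<open>The operator \<open>triple a b\<close> is multiplication by \<open>a \<odot> b\<close>
  plus the derivation \<open>D\<close>, and \<open>triple b a\<close> is the same multiplication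
  minus \<open>D\<close>. The two halves act on a triple product by \<open>triple_jprod\<close> and
  by the Leibniz rule; the minus sign of \<open>triple_jprod\<close> in the middle slot is what
  turns \<open>triple a b\<close> into \<open>triple b a\<close> there.\<close>

lemma triple_triple:
  "triple a b (triple c d e) =
    triple (triple a b c) d e - triple c (triple b a d) e + triple c d (triple a b e)"
proof -
  define D where "D x = a \<odot> (b \<odot> x) - b \<odot> (a \<odot> x)" for x
  have V: "triple a b x = (a \<odot> b) \<odot> x + D x" "triple b a x = (a \<odot> b) \<odot> x - D x" for x
    unfolding triple_def D_def by (simp_all add: jprod_commute)
  have D: "D (x \<odot> y) = D x \<odot> y + x \<odot> D y" for x y
    unfolding D_def by (rule commutator_derivation)
  have D_add: "D (x + y) = D x + D y" "D (x - y) = D x - D y" for x y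
    unfolding D_def by (simp_all add: jprod_linear)
  have "D (triple c d e) = triple (D c) d e + triple c (D d) e + triple c d (D e)"
    unfolding triple_def by (simp add: D D_add jprod_linear)
  then show ?thesis
    by (simp add: V triple_jprod triple_linear algebra_simps)
qed

text \<open>Let U = {x y {x z x}}, let U' be the same with \<open>y\<close> and \<open>z\<close>
  exchanged, and W = {x {y x z} x}. Two instances of \<open>triple_triple\<close> say U = 2 U' - W
  and U' = 2 U - W, which forces U = W.\<close>

lemma triple_exchange_outer:
  shows "triple x y (triple x z x) = triple x (triple y x z) x"
    and "triple (triple x z x) y x = triple x (triple y x z) x"
proof -
  have *: "f (triple x y (triple x z x)) = f (triple x (triple y x z) x)" if f: "linear f" for f :: "'a \<Rightarrow> real"
    using triple_triple[of x y x z x, THEN arg_cong[where f = f]]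
      triple_triple[of x z x y x, THEN arg_cong[where f = f]]
    by (simp add: linear_functional_simps[OF f]
        triple_commute[of "triple _ _ _" _ x] triple_commute[of z x y])
  show "triple x y (triple x z x) = triple x (triple y x z) x"
    by (rule linear_functionals_separate) (rule *)
  then show "triple (triple x z x) y x = triple x (triple y x z) x"
    by (simp add: triple_commute)
qed

text \<open>In this instance of \<open>triple_triple\<close> the left side reappears as the last
  summand and cancels.\<close>

lemma triple_exchange_inner:
  "triple (triple x y x) y z = triple x (triple y x y) z"
  using triple_triple[of x y x y z] by simp

text \<open>By \<open>triple_triple\<close> and the exchange rules, both sides become 2 {x {y x {y x
  z}} x} - {x {{y x y} x z} x}.\<close>

theorem fundamental_formula:
  "jtriple (jtriple x y) z = jtriple x (jtriple y (jtriple x z))"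
proof -
  define p where "p = triple x y x"
  have 1: "triple p z x = triple x (triple y x z) x"
    unfolding p_def using triple_exchange_outer(2)[of x y z] by (simp add: triple_commute)
  have 2: "triple x y (triple x (triple y x z) x) = triple x (triple y x (triple y x z)) x"
    using triple_exchange_outer(1) .
  have 3: "triple z p y = triple (triple y x y) x z"
    unfolding p_def using triple_exchange_inner[of y x z] by (simp add: triple_commute)
  have "triple p z p = triple (triple p z x) y x - triple x (triple z p y) x + triple x y (triple p z x)"
    unfolding p_def by (rule triple_triple)
  also have "triple (triple p z x) y x = triple x y (triple p z x)"
    by (rule triple_commute)
  finally have lhs: "triple p z p =
      triple x (triple y x (triple y x z)) x + triple x (triple y x (triple y x z)) x
      - triple x (triple (triple y x y) x z) x"
    unfolding 1 2 3 by simp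
  have "triple z x (triple y x y) =
      triple (triple z x y) x y - triple y (triple x z x) y + triple y x (triple z x y)"
    by (rule triple_triple)
  then have "triple y (triple x z x) y =
      triple y x (triple y x z) + triple y x (triple y x z) - triple (triple y x y) x z"
    by (simp add: triple_commute[of z x] triple_commute[of "triple y x z" x y] algebra_simps)
  then have "triple x (triple y (triple x z x) y) x = triple p z p"
    unfolding lhs by (simp add: triple_linear)
  then show ?thesis
    by (simp add: p_def triple_same)
qed

section \<open>Inverses\<close>

lemma jtriple_linear: "linear (jtriple (a::'a::jordan_algebra))"
  unfolding jtriple_def
  by (rule linearI) (simp_all add: jprod_linear algebra_simps)

lemma jprod_one_right: "(a::'a::unital_jb_algebra) \<odot> 1 = a"
  by (metis jprod_commute jprod_one_left)

lemma jtriple_one_left: "jtriple 1 (a::'a::unital_jb_algebra) = a"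
  by (simp add: jtriple_def jprod_one_left jprod_one_right scaleR_2)

lemma jtriple_one_right: "jtriple (a::'a::unital_jb_algebra) 1 = a \<odot> a"
  by (simp add: jtriple_def jprod_one_left jprod_one_right scaleR_2)

text \<open>Two instances of the linearized identity collapse because
  \<open>a \<odot> b = 1\<close>: they give (a a)(b b) = 1 and ((b b) a) a = 1. The second
  conclusion is then 2 - 1.\<close>

lemma jtriple_jinverse:
  assumes "is_jinverse a b"
  shows "jtriple a b = a" "jtriple a (b \<odot> b) = 1"
proof -
  have ab: "a \<odot> b = 1" "b \<odot> a = 1" and aab: "(a \<odot> a) \<odot> b = a" "b \<odot> (a \<odot> a) = a"
    using assms unfolding is_jinverse_def by (simp_all add: jprod_commute)
  show "jtriple a b = a"
    by (simp add: jtriple_def ab aab jprod_one_left scaleR_2)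
  note J = jordan_identity_linearized
  have 1: "(a \<odot> a) \<odot> (b \<odot> b) = 1"
    using J[of a a b b] by (simp add: ab aab jprod_one_left)
  have "2 *\<^sub>R 1 + ((b \<odot> b) \<odot> a) \<odot> a = 2 *\<^sub>R 1 + (a \<odot> a) \<odot> (b \<odot> b)"
    using J[of a b a b] by (simp add: ab aab jprod_one_left scaleR_2 jprod_commute add_ac)
  then show "jtriple a (b \<odot> b) = 1"
    by (simp add: jtriple_def 1 jprod_commute scaleR_2)
qed

text \<open>The fundamental formula turns {a (b b) a} = 1 into U_a U_{b b} U_a = id, so U_a is
  bijective, and {a b a} = a into U_a U_b U_a = U_a. Cancelling U_a identifies U_b as its
  inverse.\<close>

lemma jtriple_jinverse_cancel:
  assumes "is_jinverse a b"
  shows "jtriple a (jtriple b x) = x" "jtriple b (jtriple a x) = x"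
proof -
  have 1: "jtriple a (jtriple (b \<odot> b) (jtriple a x)) = x" for x
    using fundamental_formula[of a "b \<odot> b" x] jtriple_jinverse(2)[OF assms]
    by (simp add: jtriple_one_left)
  have 2: "jtriple a (jtriple b (jtriple a x)) = jtriple a x" for x
    using fundamental_formula[of a b x] jtriple_jinverse(1)[OF assms] by simp
  show "jtriple a (jtriple b x) = x"
    by (metis 1 2)
  have "inj (jtriple a)"
    by (metis fundamental_formula jtriple_jinverse(2)[OF assms] injI jtriple_one_left)
  then show "jtriple b (jtriple a x) = x"
    using 2 by (meson injD)
qed

lemma is_jinverse_unique:
  assumes "is_jinverse a b" "is_jinverse a c"
  shows "b = c"
  by (metis assms jtriple_jinverse(1) jtriple_jinverse_cancel(2))

lemma jinv_eq: "is_jinverse a b \<Longrightarrow> jinv a = b"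
  unfolding jinv_def by (blast intro: is_jinverse_unique)

lemma jprod_jtriple_self_commute:
  "a \<odot> jtriple a x = jtriple a (a \<odot> x)"
  unfolding jtriple_def
  by (simp add: jprod_linear) (metis jordan_identity jprod_commute)

lemma jtriple_self: "jtriple a a = (a \<odot> a) \<odot> a"
  unfolding jtriple_def by (simp add: scaleR_2)

text \<open>Multiplications by \<open>w\<close> and by \<open>w \<odot> w\<close> commute with U_w,
  hence with its inverse \<open>N\<close>. Both defining equations then reduce to N {w 1 w} = 1 and
  N {w w w} = w.\<close>

lemma is_jinverse_from_operator_inverse:
  assumes N: "\<And>x. N (jtriple w x) = x" "\<And>x. jtriple w (N x) = x"
  shows "is_jinverse w (N w)"
proof -
  have "w \<odot> N w = N (w \<odot> w)"
    by (metis N jprod_jtriple_self_commute)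
  also have "\<dots> = 1"
    using N(1)[of 1] by (simp add: jtriple_one_right)
  finally have 1: "w \<odot> N w = 1" .
  have "(w \<odot> w) \<odot> jtriple w x = jtriple w ((w \<odot> w) \<odot> x)" for x
    unfolding jtriple_def
    by (simp add: jprod_linear) (metis jordan_identity jprod_commute)
  then have "(w \<odot> w) \<odot> N w = N ((w \<odot> w) \<odot> w)"
    by (metis N)
  also have "\<dots> = w"
    using N(1)[of w] by (simp add: jtriple_self)
  finally show ?thesis
    using 1 by (simp add: is_jinverse_def)
qed

text \<open>The operator of {a b a} is U_a U_b U_a, with inverse U_a' U_b' U_a'. Applied to {a b a}
  itself, this inverse leaves U_a' U_b' b = U_a' b'.\<close>

lemma is_jinverse_jtriple:
  assumes a: "is_jinverse a a'" and b: "is_jinverse b b'"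
  shows "is_jinverse (jtriple a b) (jtriple a' b')"
proof -
  define N where "N x = jtriple a' (jtriple b' (jtriple a' x))" for x
  have "is_jinverse (jtriple a b) (N (jtriple a b))"
    by (rule is_jinverse_from_operator_inverse)
      (simp_all add: N_def fundamental_formula jtriple_jinverse_cancel[OF a] jtriple_jinverse_cancel[OF b])
  moreover have "jtriple b' b = b'"
    using jtriple_jinverse(1)[OF b] by (metis jtriple_jinverse_cancel(2)[OF b])
  ultimately show ?thesis
    by (simp add: N_def jtriple_jinverse_cancel[OF a])
qed

text \<open>The fundamental formula with middle element 1 gives U_{y y} = U_y U_y. If U_v inverts
  this, then U_v commutes with U_y, and U_y U_v is a two-sided inverse of U_y.\<close>

lemma jinvertible_square:
  assumes "jinvertible (y \<odot> y)"
  shows "jinvertible y"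
proof -
  obtain v where v: "is_jinverse (y \<odot> y) v"
    using assms unfolding jinvertible_def by blast
  have sq: "jtriple (y \<odot> y) x = jtriple y (jtriple y x)" for x
    using fundamental_formula[of y 1 x] by (simp add: jtriple_one_right jtriple_one_left)
  note inv = jtriple_jinverse_cancel[OF v, unfolded sq]
  have "jtriple y (jtriple v x) = jtriple v (jtriple y x)" for x
    by (metis inv)
  then have "is_jinverse y (jtriple y (jtriple v y))"
    by (intro is_jinverse_from_operator_inverse) (simp_all add: inv)
  then show ?thesis
    unfolding jinvertible_def by blast
qed

section \<open>Polynomials in one element\<close>

lemma bounded_bilinear_jprod: "bounded_bilinear (jprod :: 'a::jb_algebra \<Rightarrow> 'a \<Rightarrow> 'a)"
proof
  show "\<exists>K. \<forall>a b :: 'a. norm (a \<odot> b) \<le> norm a * norm b * K"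
    by (rule exI[of _ 1]) (simp add: norm_jprod_le)
qed (simp_all add: jprod_linear)

lemmas tendsto_jprod = bounded_bilinear.tendsto[OF bounded_bilinear_jprod]

lemma norm_one_le: "norm (1 :: 'a::unital_jb_algebra) \<le> 1"
proof -
  have "norm (1::'a) * 1 = norm (1::'a) * norm (1::'a)"
    using norm_jsquare[of "1::'a"] by (simp add: jprod_one_left power2_eq_square)
  then show ?thesis
    by (metis mult_cancel_left norm_zero order.refl zero_le_one)
qed

lemma bounded_linear_jtriple: "bounded_linear (jtriple (a::'a::jb_algebra))"
proof -
  have L: "bounded_linear (jprod c)" for c :: 'a
    by (rule bounded_bilinear.bounded_linear_right[OF bounded_bilinear_jprod])
  have "bounded_linear (\<lambda>b. 2 *\<^sub>R (a \<odot> (a \<odot> b)) - (a \<odot> a) \<odot> b)"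
    by (intro bounded_linear_sub L bounded_linear_const_scaleR bounded_linear_compose[OF L L])
  then show ?thesis
    unfolding jtriple_def by (simp add: jprod_commute)
qed

definition jpoly :: "real poly \<Rightarrow> 'a::unital_jb_algebra \<Rightarrow> 'a" where
  "jpoly p a = fold_coeffs (\<lambda>c y. c *\<^sub>R 1 + a \<odot> y) p 0"

lemma jpoly_0 [simp]: "jpoly 0 a = 0"
  by (simp add: jpoly_def)

lemma jpoly_pCons [simp]: "jpoly (pCons c p) a = c *\<^sub>R 1 + a \<odot> jpoly p a"
  by (cases "p = 0 \<and> c = 0") (auto simp: jpoly_def jprod_linear)

lemma jpoly_X: "jpoly [:0, 1:] a = a"
  by (simp add: jprod_linear jprod_one_right)

lemma jpoly_const: "jpoly [:c:] a = c *\<^sub>R 1"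
  by (simp add: jprod_linear)

lemma jpoly_1 [simp]: "jpoly 1 a = 1"
  by (metis jpoly_const pCons_one scaleR_one)

lemma jpoly_add: "jpoly (p + q) a = jpoly p a + jpoly q a"
  by (induction p q rule: poly_induct2) (simp_all add: jprod_linear algebra_simps)

lemma jpoly_smult: "jpoly (smult c p) a = c *\<^sub>R jpoly p a"
  by (induction p) (simp_all add: jprod_linear algebra_simps)

lemma jpoly_diff: "jpoly (p - q) a = jpoly p a - jpoly q a"
  using jpoly_add[of "p - q" q a] by simp

definition operator_commute :: "'a::jordan_algebra \<Rightarrow> 'a \<Rightarrow> bool" where
  "operator_commute x y \<longleftrightarrow> (\<forall>u. x \<odot> (y \<odot> u) = y \<odot> (x \<odot> u))"

text \<open>The linearized Jordan identity expresses multiplication by \<open>a \<odot> (a \<odot> p(a))\<close> through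
  multiplications by \<open>a\<close>, \<open>a \<odot> a\<close>, \<open>p(a)\<close> and \<open>a \<odot> p(a)\<close>. This drives the induction.\<close>

lemma commute_jpoly:
  fixes a :: "'a::unital_jb_algebra"
  assumes T: "linear T"
    and 1: "\<And>u. T (a \<odot> u) = a \<odot> T u" and 2: "\<And>u. T ((a \<odot> a) \<odot> u) = (a \<odot> a) \<odot> T u"
  shows "T (jpoly p a \<odot> u) = jpoly p a \<odot> T u"
proof -
  note T_linear = linear_functional_simps[OF T]
  have "(\<forall>u. T (jpoly p a \<odot> u) = jpoly p a \<odot> T u)
    \<and> (\<forall>u. T ((a \<odot> jpoly p a) \<odot> u) = (a \<odot> jpoly p a) \<odot> T u)"
  proof (induction p)
    case 0
    then show ?case by (simp add: jprod_linear T_linear)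
  next
    case (pCons c p)
    define x where "x = jpoly p a"
    have IH: "T (x \<odot> u) = x \<odot> T u" "T ((a \<odot> x) \<odot> u) = (a \<odot> x) \<odot> T u" for u
      using pCons.IH by (simp_all add: x_def)
    have *: "(a \<odot> (a \<odot> x)) \<odot> u =
        (a \<odot> x) \<odot> (a \<odot> u) + (a \<odot> x) \<odot> (a \<odot> u) + (a \<odot> a) \<odot> (x \<odot> u) - a \<odot> (a \<odot> (x \<odot> u)) - x \<odot> (a \<odot> (a \<odot> u))" for u
      using jordan_identity_linearized[of a x a u] by (simp add: jprod_commute algebra_simps)
    have "T ((a \<odot> (a \<odot> x)) \<odot> u) = (a \<odot> (a \<odot> x)) \<odot> T u" for u
      unfolding * by (simp add: T_linear IH 1 2)
    then show ?case
      by (simp add: x_def[symmetric] jprod_linear T_linear IH 1 2 jprod_one_left jprod_one_right)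
  qed
  then show ?thesis by blast
qed

text \<open>A bootstrap with three uses of \<open>commute_jpoly\<close>: the Jordan identity lets
  \<open>a\<close> and \<open>a \<odot> a\<close> commute, so each of them commutes with every q(a);
  therefore multiplication by p(a) satisfies the two premises itself.\<close>

lemma operator_commute_jpoly: "operator_commute (jpoly p a) (jpoly q a)"
proof -
  have sq: "operator_commute a (a \<odot> a)"
    unfolding operator_commute_def by (metis jordan_identity jprod_commute)
  have a: "operator_commute a (jpoly q a)" for q
    using commute_jpoly[OF linear_jprod_right, of a a q] sq unfolding operator_commute_def by metis
  have aa: "operator_commute (a \<odot> a) (jpoly q a)" for q
    using commute_jpoly[OF linear_jprod_right, of "a \<odot> a" a q] sq unfolding operator_commute_def by metis
  show ?thesis
    using commute_jpoly[OF linear_jprod_right, of "jpoly p a" a q] a aa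
    unfolding operator_commute_def by metis
qed

text \<open>This is power associativity: the only rebracketing required is a (p(a) q(a)) = (a p(a))
  q(a), an instance of operator commutation.\<close>

lemma jpoly_mult: "jpoly (p * q) a = jpoly p a \<odot> jpoly q a"
proof (induction p)
  case (pCons c p)
  have "a \<odot> (jpoly p a \<odot> jpoly q a) = (a \<odot> jpoly p a) \<odot> jpoly q a"
    using operator_commute_jpoly[of "[:0, 1:]" a q] unfolding jpoly_X operator_commute_def
    by (metis jprod_commute)
  with pCons show ?case
    by (simp add: jpoly_add jpoly_smult jprod_linear jprod_one_left)
qed (simp add: jprod_linear)

section \<open>The closed associative subalgebra generated by one element\<close>

definition poly_closure :: "'a::unital_jb_algebra \<Rightarrow> 'a set" where
  "poly_closure a = closure (range (\<lambda>p. jpoly p a))"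

lemma closed_poly_closure [simp]: "closed (poly_closure a)"
  by (simp add: poly_closure_def)

lemma jpoly_in_poly_closure [simp]: "jpoly p a \<in> poly_closure a"
  unfolding poly_closure_def by (rule subsetD[OF closure_subset]) simp

lemma one_in_poly_closure [simp]: "1 \<in> poly_closure a"
  using jpoly_in_poly_closure[of 1 a] by simp

lemma self_in_poly_closure [simp]: "a \<in> poly_closure a"
  by (metis jpoly_X jpoly_in_poly_closure)

lemma poly_closure_sequence:
  assumes "x \<in> poly_closure a"
  obtains p where "(\<lambda>n. jpoly (p n) a) \<longlonglongrightarrow> x"
proof -
  obtain f where f: "\<forall>n. f n \<in> range (\<lambda>p. jpoly p a)" "f \<longlonglongrightarrow> x"
    using assms unfolding poly_closure_def closure_sequential by blast
  then have "\<forall>n. \<exists>p. f n = jpoly p a" by blast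
  then obtain p where "\<And>n. f n = jpoly (p n) a" by metis
  then have "f = (\<lambda>n. jpoly (p n) a)" by blast
  then show ?thesis using that f(2) by blast
qed

lemma poly_closure_limit:
  assumes "(\<lambda>n. jpoly (p n) a) \<longlonglongrightarrow> x"
  shows "x \<in> poly_closure a"
  by (rule closed_sequentially[OF closed_poly_closure _ assms]) simp

lemma subspace_poly_closure: "subspace (poly_closure a)"
proof (rule subspaceI)
  show "0 \<in> poly_closure a"
    by (metis jpoly_0 jpoly_in_poly_closure)
next
  fix x y assume "x \<in> poly_closure a" "y \<in> poly_closure a"
  then obtain p q where "(\<lambda>n. jpoly (p n) a) \<longlonglongrightarrow> x" "(\<lambda>n. jpoly (q n) a) \<longlonglongrightarrow> y"
    by (metis poly_closure_sequence)
  then have "(\<lambda>n. jpoly (p n + q n) a) \<longlonglongrightarrow> x + y"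
    unfolding jpoly_add by (rule tendsto_add)
  then show "x + y \<in> poly_closure a"
    by (rule poly_closure_limit)
next
  fix c x assume "x \<in> poly_closure a"
  then obtain p where "(\<lambda>n. jpoly (p n) a) \<longlonglongrightarrow> x"
    by (metis poly_closure_sequence)
  then have "(\<lambda>n. jpoly (smult c (p n)) a) \<longlonglongrightarrow> c *\<^sub>R x"
    unfolding jpoly_smult by (intro tendsto_scaleR tendsto_const)
  then show "c *\<^sub>R x \<in> poly_closure a"
    by (rule poly_closure_limit)
qed

lemmas poly_closure_add = subspace_add[OF subspace_poly_closure]
lemmas poly_closure_diff = subspace_diff[OF subspace_poly_closure]
lemmas poly_closure_scaleR = subspace_scale[OF subspace_poly_closure]

lemma poly_closure_jprod:
  assumes "x \<in> poly_closure a" "y \<in> poly_closure a"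
  shows "x \<odot> y \<in> poly_closure a"
proof -
  obtain p q where "(\<lambda>n. jpoly (p n) a) \<longlonglongrightarrow> x" "(\<lambda>n. jpoly (q n) a) \<longlonglongrightarrow> y"
    using poly_closure_sequence[OF assms(1)] poly_closure_sequence[OF assms(2)] by metis
  then have "(\<lambda>n. jpoly (p n * q n) a) \<longlonglongrightarrow> x \<odot> y"
    unfolding jpoly_mult by (rule tendsto_jprod)
  then show ?thesis
    by (rule poly_closure_limit)
qed

lemma operator_commute_poly_closure:
  assumes "x \<in> poly_closure a" "y \<in> poly_closure a"
  shows "operator_commute x y"
proof -
  obtain p q where p: "(\<lambda>n. jpoly (p n) a) \<longlonglongrightarrow> x" and q: "(\<lambda>n. jpoly (q n) a) \<longlonglongrightarrow> y"
    using poly_closure_sequence[OF assms(1)] poly_closure_sequence[OF assms(2)] by metis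
  show ?thesis
    unfolding operator_commute_def
  proof
    fix u
    have "(\<lambda>n. jpoly (p n) a \<odot> (jpoly (q n) a \<odot> u)) \<longlonglongrightarrow> x \<odot> (y \<odot> u)"
      by (rule tendsto_jprod[OF p tendsto_jprod[OF q tendsto_const]])
    moreover have "(\<lambda>n. jpoly (q n) a \<odot> (jpoly (p n) a \<odot> u)) \<longlonglongrightarrow> y \<odot> (x \<odot> u)"
      by (rule tendsto_jprod[OF q tendsto_jprod[OF p tendsto_const]])
    moreover have "jpoly (q n) a \<odot> (jpoly (p n) a \<odot> u) = jpoly (p n) a \<odot> (jpoly (q n) a \<odot> u)" for n
      using operator_commute_jpoly unfolding operator_commute_def by blast
    ultimately show "x \<odot> (y \<odot> u) = y \<odot> (x \<odot> u)"
      using LIMSEQ_unique by simp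
  qed
qed

lemma poly_closure_left_commute:
  assumes "x \<in> poly_closure a" "y \<in> poly_closure a"
  shows "x \<odot> (y \<odot> z) = y \<odot> (x \<odot> z)"
  using operator_commute_poly_closure[OF assms] by (simp add: operator_commute_def)

lemma poly_closure_assoc:
  assumes "x \<in> poly_closure a" "y \<in> poly_closure a" "z \<in> poly_closure a"
  shows "x \<odot> (y \<odot> z) = (x \<odot> y) \<odot> z"
  using poly_closure_left_commute[OF assms(1,3), of y] by (simp add: jprod_commute)

lemma poly_closure_jtriple:
  assumes "x \<in> poly_closure a" "y \<in> poly_closure a"
  shows "jtriple x y = (x \<odot> x) \<odot> y"
proof -
  have "(x \<odot> y) \<odot> x = (x \<odot> x) \<odot> y"
    using poly_closure_assoc[OF assms(1) assms(1) assms(2)] by (simp add: jprod_commute)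
  then show ?thesis
    by (simp add: jtriple_def scaleR_2)
qed

lemma poly_closure_is_jinverse:
  assumes "x \<in> poly_closure a" "y \<in> poly_closure a" "x \<odot> y = 1"
  shows "is_jinverse x y"
  using assms poly_closure_assoc[of x a x y] by (simp add: is_jinverse_def jprod_one_right)

lemma jb_generated_eq: "jb_generated a = poly_closure a"
proof
  show "jb_generated a \<subseteq> poly_closure a"
    unfolding jb_generated_def
    by (rule hull_minimal) (auto simp: subspace_poly_closure poly_closure_jprod)
  define H where "H = jb_generated a"
  have H: "subspace H \<and> closed H \<and> (\<forall>x\<in>H. \<forall>y\<in>H. x \<odot> y \<in> H)"
    unfolding H_def jb_generated_def
    by (rule hull_in) (blast intro: subspace_Inter closed_Inter)
  have "{1, a} \<subseteq> H"
    unfolding H_def jb_generated_def by (rule hull_subset)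
  have "jpoly p a \<in> H" for p
    using H \<open>{1, a} \<subseteq> H\<close>
    by (induction p) (auto simp: subspace_0 intro!: subspace_add subspace_scale)
  then show "poly_closure a \<subseteq> jb_generated a"
    unfolding poly_closure_def H_def[symmetric] using H by (intro closure_minimal) auto
qed

section \<open>Squares and positivity\<close>

text \<open>The inverse is the fixed point of z \<mapsto> 1 + x z. Running the contraction inside
  the closed set \<open>poly_closure a\<close> also locates the inverse there.\<close>

lemma poly_closure_neumann:
  assumes x: "x \<in> poly_closure a" "norm x < 1"
  obtains z where "z \<in> poly_closure a" "(1 - x) \<odot> z = 1"
proof -
  have "\<exists>!z\<in>poly_closure a. 1 + x \<odot> z = z"
  proof (rule Banach_fix)
    show "complete (poly_closure a)" by (simp add: complete_eq_closed)
    show "poly_closure a \<noteq> {}" using x by blast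
    show "(\<lambda>z. 1 + x \<odot> z) ` poly_closure a \<subseteq> poly_closure a"
      using x by (auto intro!: poly_closure_add poly_closure_jprod)
    show "dist (1 + x \<odot> u) (1 + x \<odot> v) \<le> norm x * dist u v" for u v
      using norm_jprod_le[of x "u - v"] by (simp add: dist_norm jprod_linear)
  qed (use x in auto)
  then obtain z where "z \<in> poly_closure a" "1 + x \<odot> z = z" by blast
  moreover from this have "(1 - x) \<odot> z = 1"
    by (simp add: jprod_linear jprod_one_left algebra_simps)
  ultimately show ?thesis using that by blast
qed

text \<open>The square root is \<open>1 - y\<close> for the fixed point \<open>y\<close> of \<open>y \<mapsto> (x + y\<^sup>2) / 2\<close>.\<close>

lemma poly_closure_sqrt:
  assumes x: "x \<in> poly_closure a" "norm x < 1"
  obtains w where "w \<in> poly_closure a" "w \<odot> w = 1 - x"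
proof -
  define r where "r = norm x"
  have r: "0 \<le> r" "r < 1" using x by (simp_all add: r_def)
  define S where "S = poly_closure a \<inter> cball 0 r"
  define f where "f y = (1/2) *\<^sub>R (x + y \<odot> y)" for y
  have "\<exists>!y\<in>S. f y = y"
  proof (rule Banach_fix)
    show "complete S" by (simp add: S_def complete_eq_closed closed_Int)
    show "S \<noteq> {}" using subspace_0[OF subspace_poly_closure[of a]] r by (auto simp: S_def)
    show "f ` S \<subseteq> S"
    proof (rule image_subsetI)
      fix y assume y: "y \<in> S"
      have "norm (y \<odot> y) \<le> r * r"
        using y norm_jprod_le[of y y] mult_mono[of "norm y" r "norm y" r] r by (simp add: S_def)
      also have "\<dots> \<le> r" using r mult_left_le[of r r] by simp
      finally have "norm (f y) \<le> r"
        unfolding f_def using norm_triangle_ineq[of x "y \<odot> y"] by (simp add: r_def)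
      then show "f y \<in> S"
        using y x unfolding S_def f_def
        by (auto intro!: poly_closure_add poly_closure_jprod poly_closure_scaleR)
    qed
    show "dist (f u) (f v) \<le> r * dist u v" if uv: "u \<in> S" "v \<in> S" for u v
    proof -
      have "f u - f v = (1/2) *\<^sub>R ((u + v) \<odot> (u - v))"
        unfolding f_def scaleR_right_diff_distrib[symmetric]
        by (simp add: jprod_linear jprod_commute[of v u])
      then have "dist (f u) (f v) \<le> (1/2) * (norm (u + v) * norm (u - v))"
        using norm_jprod_le[of "u + v" "u - v"] by (simp add: dist_norm)
      also have "norm (u + v) \<le> 2 * r"
        using norm_triangle_ineq[of u v] uv by (simp add: S_def)
      finally show ?thesis
        by (simp add: dist_norm mult_right_mono)
    qed
  qed (use r in auto)
  then obtain y where y: "y \<in> S" "f y = y" by blast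
  then have "2 *\<^sub>R y = x + y \<odot> y"
    by (metis (no_types, lifting) f_def scaleR_scaleR mult.commute nonzero_eq_divide_eq scaleR_one zero_neq_numeral)
  then have "(1 - y) \<odot> (1 - y) = 1 - x"
    by (simp add: jprod_linear jprod_one_left jprod_one_right scaleR_2 algebra_simps)
  moreover have "1 - y \<in> poly_closure a"
    using y by (auto simp: S_def intro: poly_closure_diff)
  ultimately show ?thesis using that by blast
qed

text \<open>Positivity expressed by the norm alone: a function u on a compact set is nonnegative iff
  |s - u| \<le> s everywhere for some s. In this form sums are immediate and the spectrum, not yet
  understood, does not enter.\<close>

definition jnonneg :: "'a::unital_jb_algebra \<Rightarrow> bool" where
  "jnonneg u \<longleftrightarrow> (\<exists>s. norm (s *\<^sub>R 1 - u) \<le> s)"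

lemma jnonneg_0: "jnonneg 0"
  unfolding jnonneg_def by (rule exI[of _ 0]) simp

lemma jnonneg_add: "jnonneg u \<Longrightarrow> jnonneg v \<Longrightarrow> jnonneg (u + v)"
proof -
  assume "jnonneg u" "jnonneg v"
  then obtain s t where "norm (s *\<^sub>R 1 - u) \<le> s" "norm (t *\<^sub>R 1 - v) \<le> t"
    unfolding jnonneg_def by blast
  then have "norm ((s + t) *\<^sub>R 1 - (u + v)) \<le> s + t"
    using norm_triangle_ineq[of "s *\<^sub>R 1 - u" "t *\<^sub>R 1 - v"] by (simp add: algebra_simps)
  then show ?thesis unfolding jnonneg_def by blast
qed

lemma jnonneg_scaleR:
  assumes "jnonneg u" "0 \<le> c"
  shows "jnonneg (c *\<^sub>R u)"
proof -
  obtain s where s: "norm (s *\<^sub>R 1 - u) \<le> s"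
    using assms unfolding jnonneg_def by blast
  have "(c * s) *\<^sub>R 1 - c *\<^sub>R u = c *\<^sub>R (s *\<^sub>R 1 - u)"
    by (simp add: scaleR_right_diff_distrib)
  then have "norm ((c * s) *\<^sub>R 1 - c *\<^sub>R u) \<le> c * s"
    using s assms(2) by (simp add: mult_left_mono)
  then show ?thesis unfolding jnonneg_def by blast
qed

text \<open>Adding e > 0 makes the bound strict: x = (s - u) / (s + e) has norm below 1. Square root
  and Neumann inverse of 1 - x thus become available for u + e.\<close>

lemma jnonneg_shift_eq:
  assumes "jnonneg u" "0 < e" "u \<in> poly_closure a"
  obtains c x where "0 < c" "x \<in> poly_closure a" "norm x < 1" "u + e *\<^sub>R 1 = c *\<^sub>R (1 - x)"
proof -
  obtain s where s: "norm (s *\<^sub>R 1 - u) \<le> s"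
    using assms unfolding jnonneg_def by blast
  then have "0 \<le> s" using norm_ge_zero order_trans by blast
  define x where "x = (1 / (s + e)) *\<^sub>R (s *\<^sub>R 1 - u)"
  have "norm x < 1" "x \<in> poly_closure a"
    using s \<open>0 \<le> s\<close> assms unfolding x_def
    by (auto simp: divide_simps intro!: poly_closure_scaleR poly_closure_diff)
  have "(s + e) *\<^sub>R x = s *\<^sub>R 1 - u"
    using \<open>0 \<le> s\<close> \<open>0 < e\<close> by (simp add: x_def)
  then have "u + e *\<^sub>R 1 = (s + e) *\<^sub>R (1 - x)"
    by (simp add: scaleR_right_diff_distrib scaleR_add_left)
  moreover have "0 < s + e" using \<open>0 \<le> s\<close> \<open>0 < e\<close> by simp
  ultimately show ?thesis using that \<open>norm x < 1\<close> \<open>x \<in> poly_closure a\<close> by blast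
qed

lemma jnonneg_shift_sqrt:
  assumes "jnonneg u" "0 < e" "u \<in> poly_closure a"
  obtains w where "w \<in> poly_closure a" "w \<odot> w = u + e *\<^sub>R 1"
proof -
  obtain c x where c: "0 < c" and x: "x \<in> poly_closure a" "norm x < 1" and u: "u + e *\<^sub>R 1 = c *\<^sub>R (1 - x)"
    using jnonneg_shift_eq[OF assms] .
  obtain w where w: "w \<in> poly_closure a" "w \<odot> w = 1 - x"
    using poly_closure_sqrt[OF x] .
  show ?thesis
  proof (rule that[of "sqrt c *\<^sub>R w"])
    show "sqrt c *\<^sub>R w \<odot> sqrt c *\<^sub>R w = u + e *\<^sub>R 1"
      using c w u by (simp add: jprod_linear)
  qed (use w poly_closure_scaleR in blast)
qed

lemma jnonneg_shift_inverse:
  assumes "jnonneg u" "0 < e" "u \<in> poly_closure a"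
  obtains z where "z \<in> poly_closure a" "(u + e *\<^sub>R 1) \<odot> z = 1"
proof -
  obtain c x where c: "0 < c" and x: "x \<in> poly_closure a" "norm x < 1" and u: "u + e *\<^sub>R 1 = c *\<^sub>R (1 - x)"
    using jnonneg_shift_eq[OF assms] .
  obtain z where z: "z \<in> poly_closure a" "(1 - x) \<odot> z = 1"
    using poly_closure_neumann[OF x] .
  show ?thesis
  proof (rule that[of "(1 / c) *\<^sub>R z"])
    show "(u + e *\<^sub>R 1) \<odot> (1 / c) *\<^sub>R z = 1"
      using c z u by (simp add: jprod_linear)
  qed (use z poly_closure_scaleR in blast)
qed

text \<open>After scaling to s = 1, the element 1 - x x is itself a square w w, and the axiom
  \<open>norm_jsquare_le_add\<close> bounds its norm by that of w w + x x = 1.\<close>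

lemma norm_shift_square_le:
  fixes x :: "'a::unital_jb_algebra"
  assumes "norm x * norm x < s"
  shows "norm (s *\<^sub>R 1 - x \<odot> x) \<le> s"
proof -
  have s: "0 < s" using assms by (meson le_less_trans zero_le_square)
  define x' where "x' = (1 / sqrt s) *\<^sub>R x"
  have sq: "x' \<odot> x' = (1 / s) *\<^sub>R (x \<odot> x)"
    using s by (simp add: x'_def jprod_linear)
  then have "norm (x' \<odot> x') < 1"
    using assms s by (simp add: norm_jsquare[of x] power2_eq_square)
  then obtain w where "w \<odot> w = 1 - x' \<odot> x'"
    using poly_closure_sqrt[of "x' \<odot> x'" "x' \<odot> x'"] self_in_poly_closure by metis
  then have "norm (1 - x' \<odot> x') \<le> 1"
    using norm_jsquare_le_add[of w x'] norm_one_le[where 'a='a] by simp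
  moreover have "s *\<^sub>R 1 - x \<odot> x = s *\<^sub>R (1 - x' \<odot> x')"
    using s by (simp add: sq scaleR_right_diff_distrib)
  ultimately show ?thesis
    using s by simp
qed

lemma jnonneg_square: "jnonneg (x \<odot> x)"
  unfolding jnonneg_def using norm_shift_square_le[of x "norm x * norm x + 1"] by auto

text \<open>The norm axiom for squares extends to \<open>jnonneg\<close> elements because u + e/3
  and v + e/3 are squares. One error of e/3 comes from u and two from the sum.\<close>

lemma jnonneg_norm_le_add:
  assumes "jnonneg u" "jnonneg v"
  shows "norm u \<le> norm (u + v)"
proof (rule field_le_epsilon)
  fix e :: real assume "0 < e"
  then have e: "0 < e / 3" by simp
  obtain w where w: "w \<odot> w = u + (e/3) *\<^sub>R 1"
    using jnonneg_shift_sqrt[OF assms(1) e self_in_poly_closure] .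
  obtain w' where w': "w' \<odot> w' = v + (e/3) *\<^sub>R 1"
    using jnonneg_shift_sqrt[OF assms(2) e self_in_poly_closure] .
  have *: "norm ((e/3) *\<^sub>R (1::'a)) \<le> e/3"
    using e norm_one_le[where 'a='a] by simp
  have "norm u \<le> norm (u + (e/3) *\<^sub>R 1) + norm ((e/3) *\<^sub>R (1::'a))"
    using norm_triangle_ineq4[of "u + (e/3) *\<^sub>R 1" "(e/3) *\<^sub>R 1"] by simp
  also have "norm (u + (e/3) *\<^sub>R 1) \<le> norm ((u + (e/3) *\<^sub>R 1) + (v + (e/3) *\<^sub>R 1))"
    using norm_jsquare_le_add[of w w'] by (simp add: w w')
  also have "\<dots> = norm ((u + v) + ((e/3) *\<^sub>R 1 + (e/3) *\<^sub>R 1))"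
    by (simp add: algebra_simps)
  also have "\<dots> \<le> norm (u + v) + (norm ((e/3) *\<^sub>R (1::'a)) + norm ((e/3) *\<^sub>R (1::'a)))"
    by (meson add_left_mono norm_triangle_ineq order_trans)
  finally show "norm u \<le> norm (u + v) + e"
    using * by linarith
qed

text \<open>Inside the associative closure, (w w)(w' w') = (w w')(w w') is a square; here w w and w'
  w' are small shifts of u and v.\<close>

lemma jnonneg_jprod:
  assumes "jnonneg u" "jnonneg v" "u \<in> poly_closure a" "v \<in> poly_closure a"
  shows "jnonneg (u \<odot> v)"
proof -
  \<comment> \<open>One \<open>s\<close> exceeds the norms of all shifted products, since the shifts
    are at most 1. A bound independent of \<open>n\<close> is what survives the limit.\<close>
  define s where "s = (norm u + 1) * (norm v + 1) + 1"
  define e where "e n = 1 / real (Suc n)" for n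
  have e: "0 < e n" "e n \<le> 1" for n by (simp_all add: e_def)
  have "e \<longlonglongrightarrow> 0"
    unfolding e_def by (rule LIMSEQ_Suc[OF lim_1_over_n])
  have "norm (s *\<^sub>R 1 - (u + e n *\<^sub>R 1) \<odot> (v + e n *\<^sub>R 1)) \<le> s" for n
  proof -
    obtain w where w: "w \<in> poly_closure a" "w \<odot> w = u + e n *\<^sub>R 1"
      using jnonneg_shift_sqrt[OF assms(1) e(1) assms(3)] .
    obtain w' where w': "w' \<in> poly_closure a" "w' \<odot> w' = v + e n *\<^sub>R 1"
      using jnonneg_shift_sqrt[OF assms(2) e(1) assms(4)] .
    have "(w \<odot> w') \<odot> (w \<odot> w') = w \<odot> (w' \<odot> (w \<odot> w'))"
      by (rule poly_closure_assoc[OF w(1) w'(1) poly_closure_jprod[OF w(1) w'(1)], symmetric])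
    also have "w' \<odot> (w \<odot> w') = w \<odot> (w' \<odot> w')"
      by (rule poly_closure_left_commute[OF w'(1) w(1)])
    also have "w \<odot> (w \<odot> (w' \<odot> w')) = (w \<odot> w) \<odot> (w' \<odot> w')"
      by (rule poly_closure_assoc[OF w(1) w(1) poly_closure_jprod[OF w'(1) w'(1)]])
    finally have eq: "(w \<odot> w') \<odot> (w \<odot> w') = (u + e n *\<^sub>R 1) \<odot> (v + e n *\<^sub>R 1)"
      by (simp add: w w')
    have b: "norm (x + e n *\<^sub>R 1) \<le> norm x + 1" for x :: 'a
      using norm_triangle_ineq[of x "e n *\<^sub>R 1"] e[of n] norm_one_le[where 'a='a]
        mult_mono[of "e n" 1 "norm (1::'a)" 1] by simp
    have "norm (w \<odot> w') * norm (w \<odot> w') = norm ((u + e n *\<^sub>R 1) \<odot> (v + e n *\<^sub>R 1))"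
      using norm_jsquare[of "w \<odot> w'"] eq by (simp add: power2_eq_square)
    also have "\<dots> \<le> norm (u + e n *\<^sub>R 1) * norm (v + e n *\<^sub>R 1)"
      by (rule norm_jprod_le)
    also have "\<dots> \<le> (norm u + 1) * (norm v + 1)"
      by (intro mult_mono b) auto
    also have "\<dots> < s" by (simp add: s_def)
    finally show ?thesis
      using norm_shift_square_le[of "w \<odot> w'" s] eq by simp
  qed
  moreover have "(\<lambda>n. norm (s *\<^sub>R 1 - (u + e n *\<^sub>R 1) \<odot> (v + e n *\<^sub>R 1)))
      \<longlonglongrightarrow> norm (s *\<^sub>R 1 - (u + 0 *\<^sub>R 1) \<odot> (v + 0 *\<^sub>R 1))"
    by (intro tendsto_norm tendsto_diff tendsto_jprod tendsto_add tendsto_scaleR tendsto_const \<open>e \<longlonglongrightarrow> 0\<close>)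
  ultimately have "norm (s *\<^sub>R 1 - (u + 0 *\<^sub>R 1) \<odot> (v + 0 *\<^sub>R 1)) \<le> s"
    by (intro LIMSEQ_le_const2) auto
  then show ?thesis
    unfolding jnonneg_def by auto
qed

section \<open>The norm of a polynomial in one element\<close>

lemma norm_jtriple_le: "norm (jtriple a (b::'a::jb_algebra)) \<le> 3 * (norm a * norm a) * norm b"
proof -
  have "norm ((a \<odot> b) \<odot> a) \<le> norm (a \<odot> b) * norm a"
    by (rule norm_jprod_le)
  also have "\<dots> \<le> (norm a * norm b) * norm a"
    by (intro mult_right_mono norm_jprod_le) simp
  finally have 1: "norm ((a \<odot> b) \<odot> a) \<le> (norm a * norm b) * norm a" .
  have "norm ((a \<odot> a) \<odot> b) \<le> norm (a \<odot> a) * norm b"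
    by (rule norm_jprod_le)
  also have "\<dots> = (norm a * norm a) * norm b"
    by (simp add: norm_jsquare power2_eq_square)
  finally have 2: "norm ((a \<odot> a) \<odot> b) \<le> (norm a * norm a) * norm b" .
  have "norm (jtriple a b) \<le> 2 * norm ((a \<odot> b) \<odot> a) + norm ((a \<odot> a) \<odot> b)"
    unfolding jtriple_def using norm_triangle_ineq4[of "2 *\<^sub>R ((a \<odot> b) \<odot> a)"] by simp
  then show ?thesis
    using 1 2 by (simp add: algebra_simps)
qed

lemma map_poly_of_real_add:
  "map_poly of_real (p + q) = (map_poly of_real p + map_poly of_real q :: complex poly)"
  by (rule poly_eqI) (simp add: coeff_map_poly)

lemma poly_of_real_mult:
  "poly (map_poly of_real (p * q)) z = poly (map_poly of_real p) z * poly (map_poly of_real q) (z :: complex)"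
proof (induction p)
  case (pCons c p)
  have "map_poly of_real (smult c q) = (smult (of_real c) (map_poly of_real q) :: complex poly)"
    by (rule poly_eqI) (simp add: coeff_map_poly)
  with pCons show ?case
    by (simp add: map_poly_pCons map_poly_of_real_add algebra_simps)
qed simp

text \<open>Take a complex root b + i c. For c \<noteq> 0 the remainder modulo (t - b)^2 + c^2 is
  real of degree at most 1 and vanishes at a nonreal point, so it is zero.\<close>

lemma real_poly_factor:
  fixes q :: "real poly"
  assumes "0 < degree q"
  obtains r where "[:- r, 1:] dvd q"
  | b c where "c \<noteq> 0" "[:b\<^sup>2 + c\<^sup>2, - 2 * b, 1:] dvd q"
proof -
  have "degree (map_poly of_real q :: complex poly) = degree q"
    by (rule degree_map_poly) simp
  then obtain z :: complex where z: "poly (map_poly of_real q) z = 0"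
    using alg_closed_imp_poly_has_root[of "map_poly of_real q :: complex poly"] assms by auto
  define b where "b = Re z"
  define c where "c = Im z"
  show ?thesis
  proof (cases "c = 0")
    case True
    then have "z = of_real b"
      by (simp add: complex_eq_iff b_def c_def)
    moreover have "poly (map_poly of_real q) (of_real b :: complex) = of_real (poly q b)"
      by (induction q) (simp_all add: map_poly_pCons)
    ultimately have "poly q b = 0"
      using z by simp
    then show ?thesis
      using that(1) by (simp add: poly_eq_0_iff_dvd)
  next
    case False
    define m where "m = [:b\<^sup>2 + c\<^sup>2, - 2 * b, 1:]"
    define s where "s = q mod m"
    have "m \<noteq> 0" "degree m = 2" by (simp_all add: m_def)
    then have "degree s < 2 \<or> s = 0"
      using degree_mod_less[of m q] by (auto simp: s_def)
    then have "degree s \<le> 1" by auto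
    then obtain \<beta> \<alpha> where s: "s = [:\<beta>, \<alpha>:]"
      using degree1_coeffs by (metis le_numeral_extra(4) less_one linorder_le_less_linear degree_eq_zeroE pCons_0_0 verit_la_disequality)
    have "poly (map_poly of_real m) z = 0"
      unfolding m_def b_def c_def
      by (simp add: map_poly_pCons complex_eq_iff power2_eq_square algebra_simps)
    moreover have "q = m * (q div m) + s" by (simp add: s_def)
    then have "poly (map_poly of_real q) z =
        poly (map_poly of_real m) z * poly (map_poly of_real (q div m)) z + poly (map_poly of_real s) z"
      by (metis map_poly_of_real_add poly_add poly_of_real_mult)
    ultimately have "poly (map_poly of_real s) z = 0"
      using z by simp
    then have "of_real \<beta> + z * of_real \<alpha> = 0"
      by (simp add: s map_poly_pCons)
    then have "Im z * \<alpha> = 0" "\<beta> + Re z * \<alpha> = 0"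
      by (simp_all add: complex_eq_iff)
    then have "s = 0"
      using False by (simp add: s c_def)
    then have "m dvd q"
      by (simp add: s_def mod_eq_0_iff_dvd)
    then show ?thesis
      using that(2) False by (simp add: m_def)
  qed
qed

lemma inverse_bounded_below:
  assumes "x \<in> poly_closure a" "z \<in> poly_closure a" "u \<in> poly_closure a" "x \<odot> z = 1"
  shows "norm u \<le> norm z * norm (x \<odot> u)"
proof -
  have "z \<odot> (x \<odot> u) = (z \<odot> x) \<odot> u"
    by (rule poly_closure_assoc[OF assms(2,1,3)])
  then have "u = z \<odot> (x \<odot> u)"
    using assms(4) by (simp add: jprod_commute[of z x] jprod_one_left)
  then show ?thesis
    by (metis norm_jprod_le)
qed

lemma jinverse_bounded_below:
  assumes "x \<in> poly_closure a" "u \<in> poly_closure a" "is_jinverse x z"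
  shows "norm u \<le> (3 * (norm z * norm z) * norm x) * norm (x \<odot> u)"
proof -
  have "jtriple x u = x \<odot> (x \<odot> u)"
    using assms(1,2) by (simp add: poly_closure_jtriple poly_closure_assoc)
  then have "norm u = norm (jtriple z (x \<odot> (x \<odot> u)))"
    by (metis assms(3) jtriple_jinverse_cancel(2))
  also have "\<dots> \<le> 3 * (norm z * norm z) * norm (x \<odot> (x \<odot> u))"
    by (rule norm_jtriple_le)
  also have "\<dots> \<le> 3 * (norm z * norm z) * (norm x * norm (x \<odot> u))"
    by (intro mult_left_mono norm_jprod_le) simp
  finally show ?thesis by (simp add: mult_ac)
qed

lemma jpoly_linear_factor: "jpoly [:- r, 1:] a = a - r *\<^sub>R 1"
  by (simp add: jprod_linear jprod_one_right)

text \<open>Real linear factors are invertible by hypothesis; an irreducible quadratic factor is a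
  square plus c^2 > 0 and has an inverse in the closure.\<close>

lemma jpoly_bounded_below:
  assumes "q \<noteq> 0" "\<And>r. poly q r = 0 \<Longrightarrow> jinvertible (a - r *\<^sub>R 1)"
  shows "\<exists>K. \<forall>u\<in>poly_closure a. norm u \<le> K * norm (jpoly q a \<odot> u)"
  using assms
proof (induction "degree q" arbitrary: q rule: less_induct)
  case less
  show ?case
  proof (cases "degree q = 0")
    case True
    then obtain c where "q = [:c:]" by (rule degree_eq_zeroE)
    with less.prems have "c \<noteq> 0" "jpoly q a = c *\<^sub>R 1"
      by (auto simp: jpoly_const simp del: jpoly_pCons)
    then show ?thesis
      by (intro exI[of _ "1 / \<bar>c\<bar>"]) (simp add: jprod_linear jprod_one_left)
  next
    case False
    \<comment> \<open>Lower bounds multiply along a factorization, so one nonconstant factor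
      \<open>m\<close> has to be treated; the induction hypothesis covers the cofactor.\<close>
    have step: ?thesis if m: "m dvd q" "0 < degree m"
      and K: "\<forall>u\<in>poly_closure a. norm u \<le> K * norm (jpoly m a \<odot> u)" for m K
    proof -
      obtain k where k: "q = m * k" using m(1) by blast
      then have "k \<noteq> 0" "m \<noteq> 0" using less.prems(1) by auto
      then have "degree k < degree q" using m(2) by (simp add: k degree_mult_eq)
      moreover have "jinvertible (a - r *\<^sub>R 1)" if "poly k r = 0" for r
        using less.prems(2)[of r] that by (simp add: k)
      ultimately obtain K' where K': "\<forall>u\<in>poly_closure a. norm u \<le> K' * norm (jpoly k a \<odot> u)"
        using less.hyps \<open>k \<noteq> 0\<close> by blast
      have "norm u \<le> (\<bar>K'\<bar> * K) * norm (jpoly q a \<odot> u)" if u: "u \<in> poly_closure a" for u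
      proof -
        have ku: "jpoly k a \<odot> u \<in> poly_closure a"
          using u by (simp add: poly_closure_jprod)
        have "norm u \<le> K' * norm (jpoly k a \<odot> u)" using K' u by blast
        also have "\<dots> \<le> \<bar>K'\<bar> * norm (jpoly k a \<odot> u)"
          by (intro mult_right_mono) auto
        also have "\<dots> \<le> \<bar>K'\<bar> * (K * norm (jpoly m a \<odot> (jpoly k a \<odot> u)))"
          using K ku by (intro mult_left_mono) auto
        also have "jpoly m a \<odot> (jpoly k a \<odot> u) = jpoly q a \<odot> u"
          using u by (simp add: k jpoly_mult poly_closure_assoc[of _ a])
        finally show ?thesis by simp
      qed
      then show ?thesis by blast
    qed
    from False have "0 < degree q" by simp
    then show ?thesis
    proof (cases rule: real_poly_factor)
      case (1 r)
      then have "poly q r = 0" by (simp add: poly_eq_0_iff_dvd)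
      then obtain z where "is_jinverse (a - r *\<^sub>R 1) z"
        using less.prems(2) unfolding jinvertible_def by blast
      then have "\<forall>u\<in>poly_closure a. norm u \<le>
          (3 * (norm z * norm z) * norm (jpoly [:- r, 1:] a)) * norm (jpoly [:- r, 1:] a \<odot> u)"
        by (metis jinverse_bounded_below jpoly_in_poly_closure jpoly_linear_factor)
      from step[OF 1 _ this] show ?thesis by simp
    next
      case (2 b c)
      define m where "m = [:b\<^sup>2 + c\<^sup>2, - 2 * b, 1:]"
      have "m = [:- b, 1:] * [:- b, 1:] + [:c\<^sup>2:]"
        by (simp add: m_def power2_eq_square)
      then have m: "jpoly m a = jpoly [:- b, 1:] a \<odot> jpoly [:- b, 1:] a + c\<^sup>2 *\<^sub>R 1"
        by (metis jpoly_add jpoly_mult jpoly_const)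
      have "0 < c\<^sup>2" using 2 by simp
      obtain z where "z \<in> poly_closure a" "jpoly m a \<odot> z = 1"
        unfolding m
        using jnonneg_shift_inverse[OF jnonneg_square \<open>0 < c\<^sup>2\<close>, of "jpoly [:- b, 1:] a" a]
        by (metis jpoly_mult jpoly_in_poly_closure)
      then have "\<forall>u\<in>poly_closure a. norm u \<le> norm z * norm (jpoly m a \<odot> u)"
        by (metis inverse_bounded_below jpoly_in_poly_closure)
      moreover have "m dvd q" "0 < degree m" using 2 by (simp_all add: m_def)
      ultimately show ?thesis using step by blast
    qed
  qed
qed

text \<open>On \<open>[0, 1]\<close> one has \<open>(n + 1) y^n (1 - y) \<le> 1 - y^(n + 1)\<close>. The difference of the two sides
  is \<open>\<Sum>k\<le>n. k y^(k - 1) (1 - y)\<^sup>2\<close>, a sum of squares when \<open>y = p\<^sup>2\<close>.\<close>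

lemma norm_power_gap_le:
  assumes "norm (jpoly p a) \<le> 1"
  defines "Y \<equiv> p * p"
  shows "real (Suc n) * norm (jpoly (Y ^ n * (1 - Y)) a) \<le> 2"
proof -
  define y where "y = jpoly Y a"
  have y: "norm y \<le> 1"
    using assms by (simp add: y_def Y_def jpoly_mult norm_jsquare power_le_one)
  define D where "D n = 1 - Y ^ Suc n - smult (real (Suc n)) (Y ^ n * (1 - Y))" for n
  have D: "jnonneg (jpoly (D n) a)"
  proof (induction n)
    case 0
    show ?case by (simp add: D_def jnonneg_0)
  next
    case (Suc n)
    have "D (Suc n) = D n + smult (real (Suc n)) (p ^ n * (1 - Y) * (p ^ n * (1 - Y)))"
    proof -
      have "p ^ n * (1 - Y) * (p ^ n * (1 - Y)) = Y ^ n * (1 - Y) * (1 - Y)"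
        by (simp add: Y_def power_mult_distrib)
      moreover have "D (Suc n) - D n = smult (real (Suc n)) (Y ^ n * (1 - Y) * (1 - Y))"
        unfolding D_def
        by (simp add: algebra_simps smult_add_left smult_add_right smult_diff_right numeral_poly)
      ultimately show ?thesis by (metis add.commute diff_add_cancel)
    qed
    then show ?case
      using Suc by (simp only: jpoly_add jpoly_smult jpoly_mult)
        (intro jnonneg_add jnonneg_scaleR jnonneg_square, auto)
  qed
  have "norm (1 *\<^sub>R 1 - (1 - y)) \<le> 1" using y by simp
  then have "jnonneg (jpoly (1 - Y) a)"
    unfolding jnonneg_def jpoly_diff jpoly_1 y_def[symmetric] by blast
  moreover have "jnonneg (jpoly (Y ^ n) a)"
    by (simp add: Y_def power_mult_distrib jpoly_mult jnonneg_square)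
  ultimately have "jnonneg (jpoly (Y ^ n * (1 - Y)) a)"
    unfolding jpoly_mult by (intro jnonneg_jprod[of _ _ a]) auto
  then have 1: "jnonneg (jpoly (smult (real (Suc n)) (Y ^ n * (1 - Y))) a)"
    unfolding jpoly_smult by (rule jnonneg_scaleR) simp
  have pow: "norm (jpoly (Y ^ k) a) \<le> 1" for k
  proof (induction k)
    case (Suc k)
    have "norm (jpoly (Y ^ Suc k) a) \<le> norm y * norm (jpoly (Y ^ k) a)"
      by (simp add: jpoly_mult y_def norm_jprod_le)
    also have "\<dots> \<le> 1" using mult_mono[OF y Suc] by simp
    finally show ?case .
  qed (simp add: norm_one_le)
  \<comment> \<open>Both summands on the right are \<open>jnonneg\<close> and add up to 1 - Y^(n+1),
    whose norm is at most 2.\<close>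
  have "norm (jpoly (smult (real (Suc n)) (Y ^ n * (1 - Y))) a)
      \<le> norm (jpoly (smult (real (Suc n)) (Y ^ n * (1 - Y))) a + jpoly (D n) a)"
    by (rule jnonneg_norm_le_add[OF 1 D])
  also have "\<dots> = norm (1 - jpoly (Y ^ Suc n) a)"
    by (simp add: D_def jpoly_diff del: power_Suc)
  also have "\<dots> \<le> 2"
    using norm_triangle_ineq4[of 1 "jpoly (Y ^ Suc n) a"] pow[of "Suc n"] norm_one_le[where 'a='a]
    by linarith
  finally show ?thesis
    by (simp add: jpoly_smult)
qed

text \<open>Scale to norm 1 and let Y be the square. If |p| missed its norm on the spectrum, 1 - Y
  would have no zeros there, and multiplication by it would be bounded below by some 1/K. Then norm
  (Y^n) \<le> K norm (Y^n (1 - Y)) \<le> 2 K / (n + 1), although norm (Y^n) = 1 for arbitrarily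
  large n. This argument takes the place of a spectral radius formula.\<close>

lemma jpoly_norm_attained_nonconstant:
  assumes "jpoly p a \<noteq> 0" "0 < degree p"
  obtains r where "r \<in> jspectrum a" "\<bar>poly p r\<bar> = norm (jpoly p a)"
proof (rule ccontr)
  assume "\<not> thesis"
  with that have no: "\<bar>poly p r\<bar> \<noteq> norm (jpoly p a)" if "jinvertible (a - r *\<^sub>R 1) \<Longrightarrow> False" for r
    using that unfolding jspectrum_def by auto
  define m where "m = norm (jpoly p a)"
  have m: "0 < m" using assms by (simp add: m_def)
  define p' where "p' = smult (1 / m) p"
  define Y where "Y = p' * p'"
  have norm_p': "norm (jpoly p' a) = 1"
    using m by (simp add: p'_def jpoly_smult m_def)
  have roots: "jinvertible (a - r *\<^sub>R 1)" if "poly (1 - Y) r = 0" for r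
  proof (rule ccontr)
    assume *: "\<not> ?thesis"
    have "(poly p r)\<^sup>2 = m\<^sup>2"
      using that m by (simp add: Y_def p'_def power2_eq_square field_simps)
    then have "\<bar>poly p r\<bar> = m" using m by (auto simp: power2_eq_iff)
    then show False using no * by (auto simp: m_def)
  qed
  \<comment> \<open>\<open>norm_jsquare\<close> controls repeated squaring only, hence exponents
    that are powers of 2.\<close>
  have "norm (jpoly (Y ^ (2 ^ k)) a) = 1" for k
  proof (induction k)
    case 0
    then show ?case by (simp add: Y_def jpoly_mult norm_jsquare norm_p')
  next
    case (Suc k)
    then show ?case by (simp add: power_mult power2_eq_square power_mult_distrib mult.commute[of 2] jpoly_mult norm_jsquare)
  qed
  note norm_Y = this
  have bounded: "norm (jpoly (Y ^ (2 ^ k)) a) * 2 ^ k \<le> 2 * K" if "0 \<le> K"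
    "\<forall>u\<in>poly_closure a. norm u \<le> K * norm (jpoly (1 - Y) a \<odot> u)" for k K
  proof -
    have "norm (jpoly (Y ^ (2 ^ k)) a) \<le> K * norm (jpoly (Y ^ (2 ^ k) * (1 - Y)) a)"
      using that(2) by (simp add: jpoly_mult jprod_commute[of _ "jpoly (1 - Y) a"])
    then have "norm (jpoly (Y ^ (2 ^ k)) a) * 2 ^ k \<le> K * norm (jpoly (Y ^ (2 ^ k) * (1 - Y)) a) * 2 ^ k"
      by (intro mult_right_mono) auto
    also have "\<dots> \<le> K * (real (Suc (2 ^ k)) * norm (jpoly (Y ^ (2 ^ k) * (1 - Y)) a))"
      using that(1) by (simp add: algebra_simps)
    also have "\<dots> \<le> K * 2"
      using norm_power_gap_le[of p' a "2 ^ k"] that(1) norm_p'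
      unfolding Y_def by (intro mult_left_mono) auto
    finally show ?thesis by simp
  qed
  \<comment> \<open>A constant p could make 1 - Y the zero polynomial, which has no lower
    bound.\<close>
  have "0 < degree Y"
    using m assms(2) by (auto simp: Y_def p'_def degree_mult_eq_0 simp flip: neq0_conv)
  then have "1 - Y \<noteq> 0" by auto
  then obtain K where K: "\<forall>u\<in>poly_closure a. norm u \<le> K * norm (jpoly (1 - Y) a \<odot> u)"
    using jpoly_bounded_below roots by blast
  then have "\<forall>u\<in>poly_closure a. norm u \<le> \<bar>K\<bar> * norm (jpoly (1 - Y) a \<odot> u)"
    by (meson abs_ge_self mult_right_mono norm_ge_zero order_trans)
  then have "2 ^ k \<le> 2 * \<bar>K\<bar>" for k
    using bounded[of "\<bar>K\<bar>" k] norm_Y[of k] by simp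
  moreover obtain k :: nat where "2 * \<bar>K\<bar> < 2 ^ k"
    using real_arch_pow[of 2 "2 * \<bar>K\<bar>"] by auto
  ultimately show False by (meson not_less)
qed

lemma norm_one_eq: "(1 :: 'a::unital_jb_algebra) \<noteq> 0 \<Longrightarrow> norm (1 :: 'a) = 1"
  using norm_jsquare[of "1::'a"] by (simp add: jprod_one_left power2_eq_square)

lemma one_eq_zero_imp: "(1 :: 'a::unital_jb_algebra) = 0 \<Longrightarrow> (x :: 'a) = 0"
  using jprod_one_left[of x] by (simp add: jprod_linear)

lemma jspectrum_nonempty:
  assumes "(1 :: 'a::unital_jb_algebra) \<noteq> 0"
  shows "jspectrum (a :: 'a) \<noteq> {}"
proof (cases "a = 0")
  case True
  have "0 \<in> jspectrum (0 :: 'a)"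
    using assms by (auto simp: jspectrum_def jinvertible_def is_jinverse_def jprod_linear)
  then show ?thesis using True by blast
next
  case False
  then have "jpoly [:0, 1:] a \<noteq> 0" by (simp only: jpoly_X not_False_eq_True)
  then show ?thesis
    by (rule jpoly_norm_attained_nonconstant) auto
qed

lemma jpoly_norm_attained:
  assumes "jpoly p a \<noteq> 0"
  obtains r where "r \<in> jspectrum a" "\<bar>poly p r\<bar> = norm (jpoly p a)"
proof (cases "degree p = 0")
  case True
  then obtain c where c: "p = [:c:]" by (rule degree_eq_zeroE)
  have 1: "(1 :: 'a) \<noteq> 0" using one_eq_zero_imp assms by blast
  then obtain r where "r \<in> jspectrum a" using jspectrum_nonempty by blast
  then show ?thesis
    using that[of r] norm_one_eq[OF 1] unfolding c jpoly_const by simp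
next
  case False
  then show ?thesis using jpoly_norm_attained_nonconstant[OF assms] that by blast
qed

text \<open>If |p(r)| exceeded the norm of p(a), then p(a) - p(r) would be invertible in the closure
  by the Neumann fixed point. Its factor a - r would then be invertible too, by
  associativity.\<close>

lemma poly_spectrum_le_norm:
  assumes "r \<in> jspectrum a"
  shows "\<bar>poly p r\<bar> \<le> norm (jpoly p a)"
proof (rule ccontr)
  assume "\<not> ?thesis"
  then have less: "norm (jpoly p a) < \<bar>poly p r\<bar>" by simp
  define s where "s = poly p r"
  have "s \<noteq> 0" using less by (auto simp: s_def)
  have "poly (p - [:s:]) r = 0" by (simp add: s_def)
  then obtain q where q: "p - [:s:] = [:- r, 1:] * q"
    unfolding poly_eq_0_iff_dvd by blast
  have "norm ((1 / s) *\<^sub>R jpoly p a) < 1"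
    using less \<open>s \<noteq> 0\<close> by (simp add: s_def divide_simps)
  then obtain z where z: "z \<in> poly_closure a" "(1 - (1 / s) *\<^sub>R jpoly p a) \<odot> z = 1"
    using poly_closure_neumann[of "(1 / s) *\<^sub>R jpoly p a" a]
    by (metis jpoly_in_poly_closure poly_closure_scaleR)
  have "1 - (1 / s) *\<^sub>R jpoly p a = (- 1 / s) *\<^sub>R (jpoly (p - [:s:]) a)"
    using \<open>s \<noteq> 0\<close> by (simp add: jpoly_diff jpoly_const scaleR_right_diff_distrib del: jpoly_pCons)
  also have "\<dots> = (- 1 / s) *\<^sub>R (jpoly [:- r, 1:] a \<odot> jpoly q a)"
    by (simp only: q jpoly_mult)
  finally have "jpoly [:- r, 1:] a \<odot> ((- 1 / s) *\<^sub>R (jpoly q a \<odot> z)) = 1"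
    using z poly_closure_assoc[of "jpoly [:- r, 1:] a" a "jpoly q a" z]
    by (simp add: jprod_linear del: jpoly_pCons)
  then have "is_jinverse (jpoly [:- r, 1:] a) ((- 1 / s) *\<^sub>R (jpoly q a \<odot> z))"
    using z(1) by (intro poly_closure_is_jinverse[of _ a] poly_closure_scaleR poly_closure_jprod
        jpoly_in_poly_closure)
  then show False
    using assms unfolding jpoly_linear_factor jspectrum_def jinvertible_def by blast
qed

text \<open>Bounds by an arbitrary \<open>e \<ge> 0\<close> instead of a supremum also fit the empty
  spectrum of the zero algebra.\<close>

lemma norm_jpoly_le_iff:
  assumes "0 \<le> e"
  shows "norm (jpoly p a) \<le> e \<longleftrightarrow> (\<forall>r\<in>jspectrum a. \<bar>poly p r\<bar> \<le> e)"
proof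
  assume "norm (jpoly p a) \<le> e"
  then show "\<forall>r\<in>jspectrum a. \<bar>poly p r\<bar> \<le> e"
    using poly_spectrum_le_norm order_trans by blast
next
  assume *: "\<forall>r\<in>jspectrum a. \<bar>poly p r\<bar> \<le> e"
  show "norm (jpoly p a) \<le> e"
  proof (cases "jpoly p a = 0")
    case False
    then show ?thesis using * by (metis jpoly_norm_attained)
  qed (use assms in simp)
qed

section \<open>Functional calculus\<close>

lemma jspectrum_bound: "r \<in> jspectrum a \<Longrightarrow> \<bar>r\<bar> \<le> norm a"
  using poly_spectrum_le_norm[of r a "[:0, 1:]"] unfolding jpoly_X by simp

text \<open>If \<open>y\<close> is close to an element \<open>x\<close> with inverse \<open>z\<close>, then \<open>y\<^sup>2 = {x {z y\<^sup>2 z} x}\<close>, where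
  \<open>{z y\<^sup>2 z}\<close> is close to \<open>1\<close>.\<close>

lemma open_jinvertible: "open {a :: 'a::unital_jb_algebra. jinvertible a}"
  unfolding open_dist
proof safe
  fix x :: 'a assume "jinvertible x"
  then obtain z where z: "is_jinverse x z" unfolding jinvertible_def by blast
  define g where "g y = 1 - jtriple z (y \<odot> y)" for y
  have "isCont g x"
    unfolding g_def
    by (intro continuous_intros bounded_linear.isCont[OF bounded_linear_jtriple]
        bounded_bilinear.continuous[OF bounded_bilinear_jprod])
  moreover have "g x = 0"
    using jtriple_jinverse_cancel(2)[OF z, of 1] by (simp add: g_def jtriple_one_right)
  ultimately obtain d where "0 < d" and d: "\<And>y. dist y x < d \<Longrightarrow> norm (g y) < 1"
    unfolding continuous_at_eps_delta by (metis dist_0_norm dist_commute zero_less_one)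
  have "jinvertible y" if y: "dist y x < d" for y
  proof -
    obtain v where "v \<in> poly_closure (g y)" "(1 - g y) \<odot> v = 1"
      using poly_closure_neumann[OF self_in_poly_closure d[OF y]] .
    then have "is_jinverse (jtriple z (y \<odot> y)) v"
      using poly_closure_is_jinverse[of "1 - g y" "g y" v]
      by (simp add: poly_closure_diff) (simp add: g_def)
    then have "is_jinverse (y \<odot> y) (jtriple z v)"
      using is_jinverse_jtriple[OF z, of "jtriple z (y \<odot> y)" v] by (simp add: jtriple_jinverse_cancel(1)[OF z])
    then show ?thesis
      by (metis jinvertible_def jinvertible_square)
  qed
  then show "\<exists>e>0. \<forall>y. dist y x < e \<longrightarrow> y \<in> {a. jinvertible a}"
    using \<open>0 < d\<close> by blast
qed

lemma compact_jspectrum: "compact (jspectrum (a :: 'a::unital_jb_algebra))"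
proof -
  have "open ((\<lambda>r. a - r *\<^sub>R 1) -` {a. jinvertible a})"
    by (intro open_vimage[OF open_jinvertible] continuous_intros)
  moreover have "- jspectrum a = (\<lambda>r. a - r *\<^sub>R 1) -` {a. jinvertible a}"
    by (auto simp: jspectrum_def)
  ultimately have "closed (jspectrum a)"
    by (simp add: closed_def)
  moreover have "bounded (jspectrum a)"
    unfolding bounded_iff using jspectrum_bound by auto
  ultimately show ?thesis
    by (simp add: compact_eq_bounded_closed)
qed

text \<open>The functional calculus as a relation: the closure of the pairs (p, p(a)), uniformly on
  the spectrum and in norm simultaneously. Algebraic rules compose as derivations, and continuity is
  discharged only for existence or where \<open>jcfc\<close> appears.\<close>

definition cfc_value :: "'a::unital_jb_algebra \<Rightarrow> (real \<Rightarrow> real) \<Rightarrow> 'a \<Rightarrow> bool" where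
  "cfc_value a f y \<longleftrightarrow>
    (\<forall>e>0. \<exists>p. norm (jpoly p a - y) \<le> e \<and> (\<forall>x\<in>jspectrum a. \<bar>poly p x - f x\<bar> \<le> e))"

lemma cfc_value_approx:
  assumes "cfc_value a f y" "0 < e"
  obtains p where "norm (jpoly p a - y) \<le> e" "\<And>x. x \<in> jspectrum a \<Longrightarrow> \<bar>poly p x - f x\<bar> \<le> e"
  using assms unfolding cfc_value_def by blast

lemma cfc_value_cong:
  assumes "cfc_value a f y" "\<And>x. x \<in> jspectrum a \<Longrightarrow> f x = g x"
  shows "cfc_value a g y"
  using assms unfolding cfc_value_def by simp

lemma cfc_value_norm_le_iff:
  assumes f: "cfc_value a f y" and "0 \<le> e"
  shows "norm y \<le> e \<longleftrightarrow> (\<forall>x\<in>jspectrum a. \<bar>f x\<bar> \<le> e)"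
proof
  assume y: "norm y \<le> e"
  show "\<forall>x\<in>jspectrum a. \<bar>f x\<bar> \<le> e"
  proof
    fix x assume x: "x \<in> jspectrum a"
    show "\<bar>f x\<bar> \<le> e"
    proof (rule field_le_epsilon)
      fix d :: real assume "0 < d"
      then obtain p where p: "norm (jpoly p a - y) \<le> d/2" "\<bar>poly p x - f x\<bar> \<le> d/2"
        using cfc_value_approx[OF f, of "d/2"] x by (metis half_gt_zero)
      have "norm (jpoly p a) \<le> norm y + norm (jpoly p a - y)"
        using norm_triangle_ineq[of y "jpoly p a - y"] by simp
      then show "\<bar>f x\<bar> \<le> e + d"
        using poly_spectrum_le_norm[OF x, of p] p y by linarith
    qed
  qed
next
  assume *: "\<forall>x\<in>jspectrum a. \<bar>f x\<bar> \<le> e"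
  show "norm y \<le> e"
  proof (rule field_le_epsilon)
    fix d :: real assume "0 < d"
    then have "0 < d/2" by simp
    then obtain p where p: "norm (jpoly p a - y) \<le> d/2" "\<And>x. x \<in> jspectrum a \<Longrightarrow> \<bar>poly p x - f x\<bar> \<le> d/2"
      using cfc_value_approx[OF f] by blast
    have "\<bar>poly p x\<bar> \<le> e + d/2" if "x \<in> jspectrum a" for x
      using p(2)[OF that] bspec[OF * that] by linarith
    then have "norm (jpoly p a) \<le> e + d/2"
      using norm_jpoly_le_iff[of "e + d/2" p a] \<open>0 \<le> e\<close> \<open>0 < d\<close> by simp
    moreover have "norm y \<le> norm (jpoly p a) + norm (jpoly p a - y)"
      using norm_triangle_ineq4[of "jpoly p a" "jpoly p a - y"] by simp
    ultimately show "norm y \<le> e + d" using p(1) by linarith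
  qed
qed

lemma cfc_value_jpoly: "cfc_value a (poly p) (jpoly p a)"
  unfolding cfc_value_def by (intro allI impI exI[of _ p]) auto

lemma cfc_value_one: "cfc_value a (\<lambda>x. 1) 1"
proof -
  have "poly 1 = (\<lambda>x::real. 1)" by auto
  then show ?thesis
    using cfc_value_jpoly[of a 1] by simp
qed

lemma cfc_value_self: "cfc_value a (\<lambda>x. x) a"
proof -
  have "poly [:0, 1:] = (\<lambda>x::real. x)" by auto
  then show ?thesis
    using cfc_value_jpoly[of a "[:0, 1:]"] by (simp only: jpoly_X)
qed

lemma cfc_value_add:
  assumes "cfc_value a f y" "cfc_value a g z"
  shows "cfc_value a (\<lambda>x. f x + g x) (y + z)"
  unfolding cfc_value_def
proof safe
  fix e :: real assume "0 < e"
  then have e: "0 < e/2" by simp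
  obtain p where p: "norm (jpoly p a - y) \<le> e/2" "\<And>x. x \<in> jspectrum a \<Longrightarrow> \<bar>poly p x - f x\<bar> \<le> e/2"
    using cfc_value_approx[OF assms(1) e] by blast
  obtain q where q: "norm (jpoly q a - z) \<le> e/2" "\<And>x. x \<in> jspectrum a \<Longrightarrow> \<bar>poly q x - g x\<bar> \<le> e/2"
    using cfc_value_approx[OF assms(2) e] by blast
  have "norm (jpoly (p + q) a - (y + z)) \<le> e"
    using norm_triangle_ineq[of "jpoly p a - y" "jpoly q a - z"] p(1) q(1)
    by (simp add: jpoly_add algebra_simps)
  moreover have "\<bar>poly (p + q) x - (f x + g x)\<bar> \<le> e" if "x \<in> jspectrum a" for x
    using p(2)[OF that] q(2)[OF that] unfolding poly_add by linarith
  ultimately show "\<exists>p. norm (jpoly p a - (y + z)) \<le> e \<and> (\<forall>x\<in>jspectrum a. \<bar>poly p x - (f x + g x)\<bar> \<le> e)"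
    by blast
qed

lemma cfc_value_mult:
  assumes f: "cfc_value a f y" and g: "cfc_value a g z"
  shows "cfc_value a (\<lambda>x. f x * g x) (y \<odot> z)"
  unfolding cfc_value_def
proof safe
  fix e :: real assume "0 < e"
  \<comment> \<open>Errors at most \<open>d\<close> contribute d (norm z + 1) + norm y * d; the cap
    at 1 is what keeps the norm of q(a) below norm z + 1.\<close>
  define d where "d = min 1 (e / (norm y + norm z + 1))"
  have pos: "0 < norm y + norm z + 1"
    by (simp add: add_nonneg_pos)
  then have d: "0 < d" "d \<le> 1" using \<open>0 < e\<close> by (simp_all add: d_def)
  have "d * (norm y + norm z + 1) \<le> (e / (norm y + norm z + 1)) * (norm y + norm z + 1)"
    using pos by (intro mult_right_mono) (auto simp: d_def)
  then have de: "d * (norm y + norm z + 1) \<le> e" using pos by simp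
  obtain p where p: "norm (jpoly p a - y) \<le> d" "\<And>x. x \<in> jspectrum a \<Longrightarrow> \<bar>poly p x - f x\<bar> \<le> d"
    using cfc_value_approx[OF f d(1)] by blast
  obtain q where q: "norm (jpoly q a - z) \<le> d" "\<And>x. x \<in> jspectrum a \<Longrightarrow> \<bar>poly q x - g x\<bar> \<le> d"
    using cfc_value_approx[OF g d(1)] by blast
  have nq: "norm (jpoly q a) \<le> norm z + 1"
    using norm_triangle_ineq[of z "jpoly q a - z"] q(1) d(2) by simp
  have "jpoly (p * q) a - y \<odot> z = (jpoly p a - y) \<odot> jpoly q a + y \<odot> (jpoly q a - z)"
    by (simp add: jpoly_mult jprod_linear)
  also have "norm \<dots> \<le> norm (jpoly p a - y) * norm (jpoly q a) + norm y * norm (jpoly q a - z)"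
    by (intro order_trans[OF norm_triangle_ineq] add_mono norm_jprod_le)
  also have "\<dots> \<le> d * (norm z + 1) + norm y * d"
    using p(1) q(1) nq d by (intro add_mono mult_mono) auto
  also have "\<dots> \<le> e" using de by (simp add: algebra_simps)
  finally have 1: "norm (jpoly (p * q) a - y \<odot> z) \<le> e" .
  have 2: "\<bar>poly (p * q) x - f x * g x\<bar> \<le> e" if x: "x \<in> jspectrum a" for x
  proof -
    have "\<bar>poly (p * q) x - f x * g x\<bar> = \<bar>(poly p x - f x) * poly q x + f x * (poly q x - g x)\<bar>"
      by (simp add: algebra_simps)
    also have "\<dots> \<le> \<bar>poly p x - f x\<bar> * \<bar>poly q x\<bar> + \<bar>f x\<bar> * \<bar>poly q x - g x\<bar>"
      using abs_triangle_ineq by (metis abs_mult)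
    also have "\<dots> \<le> d * (norm z + 1) + norm y * d"
    proof (intro add_mono mult_mono)
      show "\<bar>poly q x\<bar> \<le> norm z + 1"
        using poly_spectrum_le_norm[OF x, of q] nq by simp
      show "\<bar>f x\<bar> \<le> norm y"
        using cfc_value_norm_le_iff[OF f, of "norm y"] x by simp
    qed (use p(2)[OF x] q(2)[OF x] d in auto)
    also have "\<dots> \<le> e" using de by (simp add: algebra_simps)
    finally show ?thesis .
  qed
  show "\<exists>p. norm (jpoly p a - y \<odot> z) \<le> e \<and> (\<forall>x\<in>jspectrum a. \<bar>poly p x - f x * g x\<bar> \<le> e)"
    using 1 2 by blast
qed

lemma cfc_value_scaleR:
  assumes "cfc_value a f y"
  shows "cfc_value a (\<lambda>x. c * f x) (c *\<^sub>R y)"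
  using cfc_value_mult[OF cfc_value_jpoly[of a "[:c:]"] assms]
  by (simp add: jpoly_const jprod_linear jprod_one_left del: jpoly_pCons)

lemma cfc_value_diff:
  assumes "cfc_value a f y" "cfc_value a g z"
  shows "cfc_value a (\<lambda>x. f x - g x) (y - z)"
  using cfc_value_add[OF assms(1) cfc_value_scaleR[OF assms(2), of "- 1"]] by simp

lemma cfc_value_unique:
  assumes "cfc_value a f y" "cfc_value a f z"
  shows "y = z"
  using cfc_value_norm_le_iff[OF cfc_value_diff[OF assms], of 0] by simp

lemma polynomial_approximation:
  fixes f :: "real \<Rightarrow> real"
  assumes "compact S" "continuous_on S f" "0 < e"
  obtains p where "\<And>x. x \<in> S \<Longrightarrow> \<bar>poly p x - f x\<bar> < e"
proof -
  obtain g where g: "real_polynomial_function g" "\<And>x. x \<in> S \<Longrightarrow> \<bar>f x - g x\<bar> < e"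
    using Stone_Weierstrass_real_polynomial_function[OF assms] by blast
  then obtain c n where "g = (\<lambda>x. \<Sum>i\<le>n. c i * x ^ i)"
    using real_polynomial_function_iff_sum by blast
  then have "poly (\<Sum>i\<le>n. monom (c i) i) = g"
    by (simp add: fun_eq_iff poly_sum poly_monom)
  then show ?thesis
    using that[of "\<Sum>i\<le>n. monom (c i) i"] g(2) by (simp add: abs_minus_commute)
qed

text \<open>Weierstrass polynomials p_n for f are uniformly Cauchy on the compact spectrum, so by
  \<open>norm_jpoly_le_iff\<close> the elements p_n(a) are Cauchy in norm.\<close>

lemma cfc_value_exists:
  assumes "continuous_on (jspectrum a) f"
  obtains y where "cfc_value a f y"
proof -
  have "\<exists>p. \<forall>x\<in>jspectrum a. \<bar>poly p x - f x\<bar> < 1 / real (Suc n)" for n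
    by (rule polynomial_approximation[OF compact_jspectrum assms, of "1 / real (Suc n)"]) auto
  then obtain p where p: "\<And>n x. x \<in> jspectrum a \<Longrightarrow> \<bar>poly (p n) x - f x\<bar> < 1 / real (Suc n)"
    by metis
  have "Cauchy (\<lambda>n. jpoly (p n) a)"
  proof (rule metric_CauchyI)
    fix e :: real assume "0 < e"
    then obtain N where N: "1 / real (Suc N) < e / 4"
      using nat_approx_posE[of "e/4"] by auto
    have "dist (jpoly (p m) a) (jpoly (p n) a) < e" if mn: "N \<le> m" "N \<le> n" for m n
    proof -
      have "1 / real (Suc m) \<le> 1 / real (Suc N)" "1 / real (Suc n) \<le> 1 / real (Suc N)"
        using mn by (auto intro!: divide_left_mono)
      then have "\<bar>poly (p m - p n) x\<bar> \<le> e / 2" if "x \<in> jspectrum a" for x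
        using p[OF that, of m] p[OF that, of n] N unfolding poly_diff by linarith
      then have "norm (jpoly (p m - p n) a) \<le> e / 2"
        using norm_jpoly_le_iff[of "e/2" "p m - p n" a] \<open>0 < e\<close> by auto
      then show ?thesis using \<open>0 < e\<close> by (simp add: dist_norm jpoly_diff)
    qed
    then show "\<exists>M. \<forall>m\<ge>M. \<forall>n\<ge>M. dist (jpoly (p m) a) (jpoly (p n) a) < e" by blast
  qed
  then obtain y where y: "(\<lambda>n. jpoly (p n) a) \<longlonglongrightarrow> y"
    by (meson Cauchy_convergent convergent_def)
  have "cfc_value a f y"
    unfolding cfc_value_def
  proof safe
    fix e :: real assume "0 < e"
    then obtain N where N: "1 / real (Suc N) < e"
      using nat_approx_posE[of e] by auto
    obtain M where M: "\<And>n. M \<le> n \<Longrightarrow> norm (jpoly (p n) a - y) < e"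
      using LIMSEQ_D[OF y \<open>0 < e\<close>] by blast
    have "1 / real (Suc (max M N)) \<le> 1 / real (Suc N)"
      by (auto intro!: divide_left_mono)
    then have "\<bar>poly (p (max M N)) x - f x\<bar> \<le> e" if "x \<in> jspectrum a" for x
      using p[OF that, of "max M N"] N by simp
    then show "\<exists>p. norm (jpoly p a - y) \<le> e \<and> (\<forall>x\<in>jspectrum a. \<bar>poly p x - f x\<bar> \<le> e)"
      using M[of "max M N"] less_imp_le max.cobounded1 by blast
  qed
  then show ?thesis using that by blast
qed

lemma cfc_value_in_poly_closure:
  assumes "cfc_value a f y"
  shows "y \<in> poly_closure a"
  unfolding poly_closure_def closure_approachable
proof safe
  fix e :: real assume "0 < e"
  then have "0 < e/2" by simp
  then obtain p where "norm (jpoly p a - y) \<le> e/2"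
    using cfc_value_approx[OF assms] by blast
  then have "dist (jpoly p a) y < e"
    using \<open>0 < e\<close> by (simp add: dist_norm)
  then show "\<exists>z\<in>range (\<lambda>p. jpoly p a). dist z y < e"
    by blast
qed

text \<open>Surjectivity onto the generated subalgebra: norm convergence of p_n(a) forces uniform
  convergence of p_n on the spectrum, and the uniform limit is continuous.\<close>

lemma poly_closure_imp_cfc_value:
  assumes "y \<in> poly_closure a"
  obtains f where "continuous_on (jspectrum a) f" "cfc_value a f y"
proof -
  obtain p where p: "(\<lambda>n. jpoly (p n) a) \<longlonglongrightarrow> y"
    using poly_closure_sequence[OF assms] .
  have close: "\<bar>poly (p m) x - poly (p n) x\<bar> \<le> norm (jpoly (p m) a - jpoly (p n) a)"
    if "x \<in> jspectrum a" for m n x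
    using poly_spectrum_le_norm[OF that, of "p m - p n"] by (simp add: jpoly_diff)
  have Cauchy_p: "\<exists>M. \<forall>m\<ge>M. \<forall>n\<ge>M. norm (jpoly (p m) a - jpoly (p n) a) < e" if "0 < e" for e
    using LIMSEQ_imp_Cauchy[OF p] that unfolding Cauchy_def dist_norm by blast
  define f where "f x = lim (\<lambda>n. poly (p n) x)" for x
  have f: "(\<lambda>n. poly (p n) x) \<longlonglongrightarrow> f x" if "x \<in> jspectrum a" for x
  proof -
    have "Cauchy (\<lambda>n. poly (p n) x)"
      unfolding Cauchy_def dist_norm real_norm_def
    proof safe
      fix e :: real assume "0 < e"
      then obtain M where "\<forall>m\<ge>M. \<forall>n\<ge>M. norm (jpoly (p m) a - jpoly (p n) a) < e"
        using Cauchy_p by blast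
      then show "\<exists>M. \<forall>m\<ge>M. \<forall>n\<ge>M. \<bar>poly (p m) x - poly (p n) x\<bar> < e"
        using le_less_trans[OF close[OF that]] by blast
    qed
    then show ?thesis
      unfolding f_def using Cauchy_convergent convergent_LIMSEQ_iff by blast
  qed
  have unif: "\<exists>M. \<forall>n\<ge>M. \<forall>x\<in>jspectrum a. \<bar>poly (p n) x - f x\<bar> \<le> e" if "0 < e" for e
  proof -
    obtain M where M: "\<And>m n. M \<le> m \<Longrightarrow> M \<le> n \<Longrightarrow> norm (jpoly (p m) a - jpoly (p n) a) < e"
      using Cauchy_p[OF \<open>0 < e\<close>] by blast
    have "\<bar>poly (p n) x - f x\<bar> \<le> e" if "M \<le> n" "x \<in> jspectrum a" for n x
    proof (rule LIMSEQ_le_const2)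
      show "(\<lambda>m. \<bar>poly (p n) x - poly (p m) x\<bar>) \<longlonglongrightarrow> \<bar>poly (p n) x - f x\<bar>"
        by (intro tendsto_intros f that)
      show "\<exists>N. \<forall>m\<ge>N. \<bar>poly (p n) x - poly (p m) x\<bar> \<le> e"
        using close[OF that(2)] M[OF that(1)] by (meson less_imp_le order_trans)
    qed
    then show ?thesis by blast
  qed
  have "uniform_limit (jspectrum a) (\<lambda>n. poly (p n)) f sequentially"
    unfolding uniform_limit_sequentially_iff dist_real_def
  proof safe
    fix e :: real assume "0 < e"
    then obtain M where "\<forall>n\<ge>M. \<forall>x\<in>jspectrum a. \<bar>poly (p n) x - f x\<bar> \<le> e/2"
      using unif[of "e/2"] by auto
    moreover have "e/2 < e" using \<open>0 < e\<close> by simp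
    ultimately show "\<exists>N. \<forall>n\<ge>N. \<forall>x\<in>jspectrum a. \<bar>poly (p n) x - f x\<bar> < e"
      by (meson le_less_trans)
  qed
  then have "continuous_on (jspectrum a) f"
    by (rule uniform_limit_theorem[rotated]) (simp_all add: continuous_on_poly continuous_on_id)
  moreover have "cfc_value a f y"
    unfolding cfc_value_def
  proof safe
    fix e :: real assume "0 < e"
    obtain M where "\<And>n. M \<le> n \<Longrightarrow> norm (jpoly (p n) a - y) < e"
      using LIMSEQ_D[OF p \<open>0 < e\<close>] by blast
    moreover obtain N where "\<forall>n\<ge>N. \<forall>x\<in>jspectrum a. \<bar>poly (p n) x - f x\<bar> \<le> e"
      using unif[OF \<open>0 < e\<close>] by blast
    ultimately show "\<exists>p. norm (jpoly p a - y) \<le> e \<and> (\<forall>x\<in>jspectrum a. \<bar>poly p x - f x\<bar> \<le> e)"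
      by (meson less_imp_le max.cobounded1 max.cobounded2)
  qed
  ultimately show ?thesis using that by blast
qed

lemma sup_norm_on_le:
  assumes "0 \<le> e" "\<And>x. x \<in> S \<Longrightarrow> \<bar>f x\<bar> \<le> e"
  shows "sup_norm_on S f \<le> e"
  unfolding sup_norm_on_def using assms by (intro cSup_least) auto

lemma cfc_value_norm:
  assumes "cfc_value a f y"
  shows "norm y = sup_norm_on (jspectrum a) f"
proof (rule antisym)
  have b: "\<bar>f x\<bar> \<le> norm y" if "x \<in> jspectrum a" for x
    using cfc_value_norm_le_iff[OF assms, of "norm y"] that by simp
  then show "sup_norm_on (jspectrum a) f \<le> norm y"
    by (intro sup_norm_on_le) auto
  have bdd: "bdd_above (insert 0 ((\<lambda>x. \<bar>f x\<bar>) ` jspectrum a))"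
    using b by (auto intro!: bdd_aboveI2)
  have "0 \<le> sup_norm_on (jspectrum a) f"
    unfolding sup_norm_on_def by (intro cSup_upper bdd) auto
  moreover have "\<bar>f x\<bar> \<le> sup_norm_on (jspectrum a) f" if "x \<in> jspectrum a" for x
    unfolding sup_norm_on_def using that by (intro cSup_upper bdd) auto
  ultimately show "norm y \<le> sup_norm_on (jspectrum a) f"
    using cfc_value_norm_le_iff[OF assms] by blast
qed

lemma functional_calculus_exists: "\<exists>\<Phi>. is_functional_calculus a \<Phi>"
proof -
  define \<Phi> where "\<Phi> f = (SOME y. cfc_value a f y)" for f
  have \<Phi>: "\<Phi> f = y" if "cfc_value a f y" for f y
    using that unfolding \<Phi>_def by (meson cfc_value_unique someI_ex)
  have val: "cfc_value a f (\<Phi> f)" if "continuous_on (jspectrum a) f" for f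
    using cfc_value_exists[OF that] \<Phi> by metis
  have "is_functional_calculus a \<Phi>"
    unfolding is_functional_calculus_def Let_def mem_Collect_eq Ball_def
  proof (intro conjI allI impI)
    show "\<Phi> ` {f. continuous_on (jspectrum a) f} = jb_generated a"
      unfolding jb_generated_eq
    proof safe
      fix f :: "real \<Rightarrow> real" assume "continuous_on (jspectrum a) f"
      then show "\<Phi> f \<in> poly_closure a"
        using val cfc_value_in_poly_closure by blast
    next
      fix y assume "y \<in> poly_closure a"
      then obtain f where "continuous_on (jspectrum a) f" "cfc_value a f y"
        by (rule poly_closure_imp_cfc_value)
      then show "y \<in> \<Phi> ` {f. continuous_on (jspectrum a) f}"
        using \<Phi> by blast
    qed
  qed (auto intro!: \<Phi> val cfc_value_norm cfc_value_add cfc_value_scaleR cfc_value_mult cfc_value_one cfc_value_self)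
  then show ?thesis by blast
qed

text \<open>Uniqueness: the homomorphism clauses determine \<Phi> on polynomials, and isometry with
  Weierstrass approximation determines the rest.\<close>

lemma functional_calculus_cfc_value:
  assumes \<Phi>: "is_functional_calculus a \<Phi>" and f: "continuous_on (jspectrum a) f"
  shows "cfc_value a f (\<Phi> f)"
proof -
  define C where "C = {g :: real \<Rightarrow> real. continuous_on (jspectrum a) g}"
  have add: "\<Phi> (\<lambda>x. g x + h x) = \<Phi> g + \<Phi> h" if "g \<in> C" "h \<in> C" for g h
    using \<Phi> that by (simp add: is_functional_calculus_def Let_def C_def)
  have scale: "\<Phi> (\<lambda>x. r * g x) = r *\<^sub>R \<Phi> g" if "g \<in> C" for g r
    using \<Phi> that by (simp add: is_functional_calculus_def Let_def C_def)
  have mult: "\<Phi> (\<lambda>x. g x * h x) = \<Phi> g \<odot> \<Phi> h" if "g \<in> C" "h \<in> C" for g h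
    using \<Phi> that by (simp add: is_functional_calculus_def Let_def C_def)
  have one: "\<Phi> (\<lambda>x. 1) = 1" and self: "\<Phi> (\<lambda>x. x) = a"
    using \<Phi> by (simp_all add: is_functional_calculus_def Let_def)
  have norm: "norm (\<Phi> g) = sup_norm_on (jspectrum a) g" if "g \<in> C" for g
    using \<Phi> that by (simp add: is_functional_calculus_def Let_def C_def)
  have C: "poly p \<in> C" "(\<lambda>x. c) \<in> C" "(\<lambda>x. x) \<in> C" "(\<lambda>x. x * poly p x) \<in> C" "f \<in> C" for p c
    unfolding C_def using f by (auto intro!: continuous_intros)
  have poly: "\<Phi> (poly p) = jpoly p a" for p
  proof (induction p)
    case 0
    have "poly 0 = (\<lambda>x::real. 0 * 1)" by auto
    then have "\<Phi> (poly 0) = 0 *\<^sub>R \<Phi> (\<lambda>x. 1)"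
      using scale[OF C(2)] by metis
    then show ?case by (simp only: scaleR_zero_left jpoly_0)
  next
    case (pCons c p)
    have "poly (pCons c p) = (\<lambda>x. (c * 1) + x * poly p x)" by auto
    then have "\<Phi> (poly (pCons c p)) = \<Phi> (\<lambda>x. c * 1) + \<Phi> (\<lambda>x. x * poly p x)"
      using add[OF C(2) C(4)] by metis
    also have "\<Phi> (\<lambda>x. c * 1) = c *\<^sub>R 1"
      using scale[OF C(2)] one by metis
    also have "\<Phi> (\<lambda>x. x * poly p x) = a \<odot> jpoly p a"
      using mult[OF C(3) C(1)] self pCons.IH by metis
    finally show ?case by simp
  qed
  show ?thesis
    unfolding cfc_value_def
  proof safe
    fix e :: real assume "0 < e"
    then obtain p where p: "\<And>x. x \<in> jspectrum a \<Longrightarrow> \<bar>poly p x - f x\<bar> < e"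
      using polynomial_approximation[OF compact_jspectrum f] by blast
    \<comment> \<open>The clauses for \<Phi> mention sums and multiples but no differences, so the
      difference is spelled out in that shape.\<close>
    have D: "(\<lambda>x. - 1 * f x) \<in> C" "(\<lambda>x. poly p x + - 1 * f x) \<in> C"
      unfolding C_def using f by (auto intro!: continuous_intros)
    have "\<Phi> (\<lambda>x. poly p x + - 1 * f x) = jpoly p a - \<Phi> f"
      using add[OF C(1) D(1)] scale[OF C(5), of "- 1"] poly by simp
    then have "norm (jpoly p a - \<Phi> f) = sup_norm_on (jspectrum a) (\<lambda>x. poly p x + - 1 * f x)"
      using norm[OF D(2)] by simp
    also have "\<dots> \<le> e"
      using p \<open>0 < e\<close> by (intro sup_norm_on_le) (auto simp: less_imp_le)
    finally show "\<exists>p. norm (jpoly p a - \<Phi> f) \<le> e \<and> (\<forall>x\<in>jspectrum a. \<bar>poly p x - f x\<bar> \<le> e)"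
      using p less_imp_le by blast
  qed
qed

lemma jcfc_eq:
  assumes "continuous_on (jspectrum a) f" "cfc_value a f y"
  shows "jcfc f a = y"
  unfolding jcfc_def
proof (rule the_equality)
  show "\<exists>\<Phi>. is_functional_calculus a \<Phi> \<and> y = \<Phi> f"
    using functional_calculus_exists functional_calculus_cfc_value assms cfc_value_unique by metis
  show "x = y" if "\<exists>\<Phi>. is_functional_calculus a \<Phi> \<and> x = \<Phi> f" for x
    using that functional_calculus_cfc_value assms cfc_value_unique by metis
qed

lemma cfc_value_jcfc:
  assumes "continuous_on (jspectrum a) f"
  shows "cfc_value a f (jcfc f a)"
  using cfc_value_exists[OF assms] jcfc_eq[OF assms] by metis

section \<open>Positive elements and means\<close>

lemma jspectrum_pos:
  assumes "jpositive a" "jinvertible a" "r \<in> jspectrum a"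
  shows "0 < r"
proof -
  have "0 \<notin> jspectrum a"
    using assms(2) by (simp add: jspectrum_def)
  then show ?thesis
    using assms(1,3) unfolding jpositive_def by (metis atLeast_iff order_le_less subsetD)
qed

lemma jspectrum_lower_bound:
  assumes "jpositive a" "jinvertible a"
  obtains c where "0 < c" "\<And>r. r \<in> jspectrum a \<Longrightarrow> c \<le> r"
proof (cases "jspectrum a = {}")
  case False
  obtain c where "c \<in> jspectrum a" "\<And>r. r \<in> jspectrum a \<Longrightarrow> c \<le> r"
    using compact_attains_inf[OF compact_jspectrum False] by blast
  then show ?thesis
    using that jspectrum_pos[OF assms] by blast
\<comment> \<open>An empty spectrum occurs only in the zero algebra; any positive constant will
  do.\<close>
qed (use that[of 1] in auto)

text \<open>With c a lower bound of the spectrum, \<open>a - c *\<^sub>R 1\<close> is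
  \<open>jnonneg\<close> with witness s = norm a, because 0 < norm a + c - r \<le> norm a on the
  spectrum. Adding b preserves this, and the shift by c restores a + b as an invertible
  element.\<close>

lemma jinvertible_add_jnonneg:
  assumes a: "jpositive a" "jinvertible a" and b: "jnonneg b"
  shows "jinvertible (a + b)"
proof -
  obtain c where c: "0 < c" "\<And>r. r \<in> jspectrum a \<Longrightarrow> c \<le> r"
    using jspectrum_lower_bound[OF a] by blast
  have "\<bar>poly [:norm a + c, - 1:] r\<bar> \<le> norm a" if "r \<in> jspectrum a" for r
    using jspectrum_bound[OF that] c(2)[OF that] c(1) by auto
  then have "norm (jpoly [:norm a + c, - 1:] a) \<le> norm a"
    using norm_jpoly_le_iff[OF norm_ge_zero[of a], of "[:norm a + c, - 1:]" a] by blast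
  moreover have "jpoly [:norm a + c, - 1:] a = norm a *\<^sub>R 1 - (a - c *\<^sub>R 1)"
    by (simp add: jprod_linear jprod_one_right scaleR_add_left)
  ultimately have "jnonneg (a - c *\<^sub>R 1)"
    unfolding jnonneg_def by metis
  then have "jnonneg (a - c *\<^sub>R 1 + b)"
    using b by (rule jnonneg_add)
  then obtain z where z: "z \<in> poly_closure (a - c *\<^sub>R 1 + b)" "(a - c *\<^sub>R 1 + b + c *\<^sub>R 1) \<odot> z = 1"
    using jnonneg_shift_inverse[OF _ c(1) self_in_poly_closure] by metis
  have "is_jinverse (a - c *\<^sub>R 1 + b + c *\<^sub>R 1) z"
    by (rule poly_closure_is_jinverse[OF _ z])
      (intro poly_closure_add poly_closure_scaleR self_in_poly_closure one_in_poly_closure)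
  then have "jinvertible (a - c *\<^sub>R 1 + b + c *\<^sub>R 1)"
    unfolding jinvertible_def by blast
  then show ?thesis by (simp add: algebra_simps)
qed

text \<open>For \<open>r < 0\<close>, \<open>{a b a} - r = {a (b - r a\<^sup>-\<^sup>2) a}\<close> is invertible.\<close>

lemma jpositive_jtriple:
  assumes a: "is_jinverse a a'" and b: "jpositive b" "jinvertible b"
  shows "jpositive (jtriple a b)" "jinvertible (jtriple a b)"
proof -
  have inv: "jinvertible (jtriple a x)" if "jinvertible x" for x
    using that is_jinverse_jtriple[OF a] unfolding jinvertible_def by blast
  then show "jinvertible (jtriple a b)" using b by blast
  have "jinvertible (jtriple a b - r *\<^sub>R 1)" if "r < 0" for r
  proof -
    have "jnonneg ((- r) *\<^sub>R (a' \<odot> a'))"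
      using that by (intro jnonneg_scaleR jnonneg_square) simp
    then have "jinvertible (jtriple a (b + (- r) *\<^sub>R (a' \<odot> a')))"
      by (intro inv jinvertible_add_jnonneg b)
    also have "jtriple a (b + (- r) *\<^sub>R (a' \<odot> a')) = jtriple a b - r *\<^sub>R 1"
      using jtriple_jinverse(2)[OF a]
      by (simp only: linear_add[OF jtriple_linear] linear_scale[OF jtriple_linear]) simp
    finally show ?thesis .
  qed
  then show "jpositive (jtriple a b)"
    unfolding jpositive_def jspectrum_def by (auto simp: not_less[symmetric])
qed

lemma cfc_value_is_jinverse:
  assumes "cfc_value a f y" "cfc_value a g z" "\<And>x. x \<in> jspectrum a \<Longrightarrow> f x * g x = 1"
  shows "is_jinverse y z"
proof (rule poly_closure_is_jinverse)
  show "y \<odot> z = 1"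
    using cfc_value_unique[OF cfc_value_cong[OF cfc_value_mult[OF assms(1,2)]] cfc_value_one] assms(3) by blast
qed (use assms cfc_value_in_poly_closure in blast)+

lemma cfc_value_jpowr:
  assumes "jpositive a" "jinvertible a"
  shows "cfc_value a (\<lambda>x. x powr r) (jpowr a r)"
  unfolding jpowr_def
  by (intro cfc_value_jcfc continuous_intros) (use jspectrum_pos[OF assms] in force)

lemma cfc_value_jinv:
  assumes "jpositive a" "jinvertible a"
  shows "cfc_value a (\<lambda>x. 1 / x) (jinv a)" "is_jinverse a (jinv a)"
proof -
  have "continuous_on (jspectrum a) (\<lambda>x. 1 / x)"
    by (intro continuous_intros) (use jspectrum_pos[OF assms] in force)
  then obtain y where y: "cfc_value a (\<lambda>x. 1 / x) y"
    by (rule cfc_value_exists)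
  have "is_jinverse a y"
    by (rule cfc_value_is_jinverse[OF cfc_value_self y]) (use jspectrum_pos[OF assms] in force)
  moreover from this have "jinv a = y" by (rule jinv_eq)
  ultimately show "cfc_value a (\<lambda>x. 1 / x) (jinv a)" "is_jinverse a (jinv a)"
    using y by simp_all
qed

lemma jpowr_half_is_jinverse:
  assumes "jpositive a" "jinvertible a"
  shows "is_jinverse (jpowr a (1/2)) (jpowr a (- 1/2))" "is_jinverse (jpowr a (- 1/2)) (jpowr a (1/2))"
  by (rule cfc_value_is_jinverse[OF cfc_value_jpowr cfc_value_jpowr];
      use assms jspectrum_pos[OF assms] in \<open>force simp flip: powr_add\<close>)+

lemma jinv_eq_jpowr_square:
  assumes "jpositive a" "jinvertible a"
  shows "jinv a = jpowr a (- 1/2) \<odot> jpowr a (- 1/2)"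
proof (rule cfc_value_unique[OF cfc_value_jinv(1)[OF assms]])
  have "cfc_value a (\<lambda>x. x powr (- 1/2) * x powr (- 1/2)) (jpowr a (- 1/2) \<odot> jpowr a (- 1/2))"
    by (intro cfc_value_mult cfc_value_jpowr assms)
  then show "cfc_value a (\<lambda>x. 1 / x) (jpowr a (- 1/2) \<odot> jpowr a (- 1/2))"
    by (rule cfc_value_cong)
      (use jspectrum_pos[OF assms] in \<open>force simp: powr_minus_divide simp flip: powr_add\<close>)
qed

text \<open>Both inverses have the outer factor z = A^(-1/2): the inverse of A is {z 1 z} and that
  of B is {z C^(-1) z}. The function in the premise is 1 / (\<alpha> + \<beta> / x) with the nested
  fraction cleared.\<close>

lemma weighted_inverse_sum:
  fixes A B :: "'a::unital_jb_algebra"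
  assumes A: "jpositive A" "jinvertible A" and B: "jpositive B" "jinvertible B"
    and weights: "0 \<le> \<alpha>" "0 \<le> \<beta>" "0 < \<alpha> + \<beta>"
  defines "C \<equiv> jtriple (jpowr A (- 1/2)) B"
  assumes y: "cfc_value C (\<lambda>x. x / (\<alpha> * x + \<beta>)) y"
  shows "jinv (\<alpha> *\<^sub>R jinv A + \<beta> *\<^sub>R jinv B) = jtriple (jpowr A (1/2)) y"
proof (rule jinv_eq)
  define w where "w = jpowr A (1/2)"
  define z where "z = jpowr A (- 1/2)"
  have wz: "is_jinverse w z" and zw: "is_jinverse z w"
    unfolding w_def z_def by (rule jpowr_half_is_jinverse[OF A])+
  have C: "jpositive C" "jinvertible C"
    unfolding C_def z_def[symmetric] by (rule jpositive_jtriple[OF zw B])+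
  have "is_jinverse C (jtriple w (jinv B))"
    unfolding C_def z_def[symmetric] by (rule is_jinverse_jtriple[OF zw cfc_value_jinv(2)[OF B]])
  then have "jinv C = jtriple w (jinv B)" by (rule jinv_eq)
  then have B': "jinv B = jtriple z (jinv C)"
    by (simp add: jtriple_jinverse_cancel[OF zw])
  have A': "jinv A = jtriple z 1"
    by (simp add: jtriple_one_right z_def jinv_eq_jpowr_square[OF A])
  have eq: "\<alpha> *\<^sub>R jinv A + \<beta> *\<^sub>R jinv B = jtriple z (\<alpha> *\<^sub>R 1 + \<beta> *\<^sub>R jinv C)"
    unfolding A' B' by (simp only: linear_add[OF jtriple_linear] linear_scale[OF jtriple_linear])
  have "cfc_value C (\<lambda>x. \<alpha> * 1 + \<beta> * (1 / x)) (\<alpha> *\<^sub>R 1 + \<beta> *\<^sub>R jinv C)"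
    by (intro cfc_value_add cfc_value_scaleR cfc_value_one cfc_value_jinv C)
  then have "is_jinverse (\<alpha> *\<^sub>R 1 + \<beta> *\<^sub>R jinv C) y"
  proof (rule cfc_value_is_jinverse[OF _ y])
    fix x assume "x \<in> jspectrum C"
    then have x: "0 < x" by (rule jspectrum_pos[OF C])
    have "0 < \<alpha> * x + \<beta>"
      using weights x by (cases "\<alpha> = 0") (auto intro: add_pos_nonneg)
    moreover have "\<alpha> * 1 + \<beta> * (1 / x) = (\<alpha> * x + \<beta>) / x"
      using x by (simp add: field_simps)
    ultimately show "(\<alpha> * 1 + \<beta> * (1 / x)) * (x / (\<alpha> * x + \<beta>)) = 1"
      using x by simp
  qed
  then show "is_jinverse (\<alpha> *\<^sub>R jinv A + \<beta> *\<^sub>R jinv B) (jtriple (jpowr A (1/2)) y)"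
    unfolding eq w_def[symmetric] by (rule is_jinverse_jtriple[OF zw])
qed

section \<open>Integration\<close>

lemma cfc_value_sum:
  assumes "finite I" "\<And>i. i \<in> I \<Longrightarrow> cfc_value a (g i) (z i)"
  shows "cfc_value a (\<lambda>x. \<Sum>i\<in>I. g i x) (\<Sum>i\<in>I. z i)"
  using assms
proof (induction I rule: finite_induct)
  case empty
  then show ?case using cfc_value_scaleR[OF cfc_value_one, of a 0] by simp
next
  case (insert i I)
  then show ?case by (simp add: cfc_value_add)
qed

text \<open>The Riemann sums of \<open>h\<close> converge uniformly on the spectrum, and the functional calculus is isometric.\<close>

lemma has_riemann_integral_cfc:
  fixes a :: "'a::unital_jb_algebra"
  assumes T: "bounded_linear T" and uv: "u \<le> v"
    and cont: "continuous_on ({u..v} \<times> jspectrum a) (\<lambda>(t, x). h t x)"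
    and int: "\<And>x. x \<in> jspectrum a \<Longrightarrow> ((\<lambda>t. h t x) has_integral F x) {u..v}"
    and J: "cfc_value a F J"
    and f: "\<And>t. t \<in> {u..v} \<Longrightarrow> \<exists>y. cfc_value a (h t) y \<and> f t = T y"
  shows "has_riemann_integral f (T J) u v"
  unfolding has_riemann_integral_def
proof safe
  fix e :: real assume "0 < e"
  obtain K where K: "0 < K" "\<And>x. norm (T x) \<le> norm x * K"
    using bounded_linear.pos_bounded[OF T] by blast
  \<comment> \<open>The total error will be e' (v - u) K; the summand 1 keeps the denominator
    positive when u = v.\<close>
  define e' where "e' = e / (2 * K * (v - u + 1))"
  have e': "0 < e'" using \<open>0 < e\<close> K uv by (simp add: e'_def)
  have "e' * (v - u) * K \<le> e' * (v - u + 1) * K"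
    using e' K by (intro mult_right_mono mult_left_mono) auto
  also have "\<dots> = e / 2" using K uv by (simp add: e'_def)
  also have "\<dots> < e" using \<open>0 < e\<close> by simp
  finally have e'_e: "e' * (v - u) * K < e" .
  have "compact ({u..v} \<times> jspectrum a)"
    by (intro compact_Times compact_jspectrum compact_Icc)
  then have "uniformly_continuous_on ({u..v} \<times> jspectrum a) (\<lambda>(t, x). h t x)"
    using cont compact_uniformly_continuous by blast
  \<comment> \<open>Uniform continuity on the product provides a single radius for all points x of
    the spectrum, as the constant gauges of \<open>has_riemann_integral\<close> demand.\<close>
  then obtain d where d: "0 < d"
    "\<And>p q. p \<in> {u..v} \<times> jspectrum a \<Longrightarrow> q \<in> {u..v} \<times> jspectrum a \<Longrightarrow> dist q p < d \<Longrightarrow>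
      dist (case q of (t, x) \<Rightarrow> h t x) (case p of (t, x) \<Rightarrow> h t x) < e'"
    unfolding uniformly_continuous_on_def using e' by metis
  have close: "\<bar>h s x - h t x\<bar> < e'" if "s \<in> {u..v}" "t \<in> {u..v}" "x \<in> jspectrum a" "dist s t < d" for s t x
    using d(2)[of "(t, x)" "(s, x)"] that by (simp add: dist_real_def dist_Pair_Pair)
  obtain y where y: "\<And>t. t \<in> {u..v} \<Longrightarrow> cfc_value a (h t) (y t)" "\<And>t. t \<in> {u..v} \<Longrightarrow> f t = T (y t)"
    using f by metis
  show "\<exists>d>0. \<forall>D. D tagged_division_of {u..v} \<and> (\<lambda>x. ball x d) fine D \<longrightarrow>
      norm ((\<Sum>(x, k)\<in>D. measure lborel k *\<^sub>R f x) - T J) < e"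
  proof (intro exI conjI allI impI)
    show "0 < d" by (rule d)
    fix D assume "D tagged_division_of {u..v} \<and> (\<lambda>x. ball x d) fine D"
    then have D: "D tagged_division_of {u..v}" and fine: "(\<lambda>x. ball x d) fine D" by auto
    have D_cbox: "D tagged_division_of cbox u v" using D by simp
    have tag: "t \<in> {u..v}" if "(t, k) \<in> D" for t k
      using tagged_division_ofD(2,3)[OF D that] by blast
    define S where "S = (\<Sum>(t, k)\<in>D. measure lborel k *\<^sub>R y t)"
    have "(\<Sum>(t, k)\<in>D. measure lborel k *\<^sub>R f t) = (\<Sum>(t, k)\<in>D. T (measure lborel k *\<^sub>R y t))"
      by (intro sum.cong) (auto simp: y(2)[OF tag] linear_scale[OF bounded_linear.linear[OF T]])
    also have "\<dots> = T S"
      by (simp add: S_def linear_sum[OF bounded_linear.linear[OF T]] case_prod_unfold)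
    finally have TS: "(\<Sum>(t, k)\<in>D. measure lborel k *\<^sub>R f t) = T S" .
    have "cfc_value a (\<lambda>x. \<Sum>tk\<in>D. measure lborel (snd tk) * h (fst tk) x)
        (\<Sum>tk\<in>D. measure lborel (snd tk) *\<^sub>R y (fst tk))"
      using tagged_division_ofD(1)[OF D] tag y(1)
      by (intro cfc_value_sum cfc_value_scaleR) auto
    then have "cfc_value a (\<lambda>x. (\<Sum>tk\<in>D. measure lborel (snd tk) * h (fst tk) x) - F x) (S - J)"
      unfolding S_def case_prod_unfold by (rule cfc_value_diff[OF _ J])
    moreover have "\<bar>(\<Sum>tk\<in>D. measure lborel (snd tk) * h (fst tk) x) - F x\<bar> \<le> e' * (v - u)"
      if x: "x \<in> jspectrum a" for x
    proof -
      have int_x: "(\<lambda>t. h t x) integrable_on cbox u v"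
        using int[OF x] by (auto simp: integrable_on_def)
      have "F x = (\<Sum>(t, k)\<in>D. integral k (\<lambda>t. h t x))"
        using integral_combine_tagged_division_topdown[OF int_x D_cbox] integral_unique[OF int[OF x]]
        by simp
      then have "(\<Sum>tk\<in>D. measure lborel (snd tk) * h (fst tk) x) - F x
          = (\<Sum>(t, k)\<in>D. measure lborel k * h t x - integral k (\<lambda>t. h t x))"
        by (simp add: case_prod_unfold sum_subtractf)
      also have "\<bar>\<dots>\<bar> \<le> (\<Sum>(t, k)\<in>D. \<bar>measure lborel k * h t x - integral k (\<lambda>t. h t x)\<bar>)"
        by (simp add: case_prod_unfold sum_abs)
      also have "\<dots> \<le> (\<Sum>(t, k)\<in>D. e' * measure lborel k)"
      \<comment> \<open>On a cell, h oscillates by less than e' around its value at the tag, so the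
        cell contributes at most e' times its length.\<close>
      proof (rule sum_mono, clarify)
        fix t k assume tk: "(t, k) \<in> D"
        obtain b c where k: "k = cbox b c" using tagged_division_ofD(4)[OF D tk] by blast
        have sub: "k \<subseteq> {u..v}" and t: "t \<in> k" using tagged_division_ofD(2,3)[OF D tk] by auto
        have ball: "k \<subseteq> ball t d" using fine tk unfolding fine_def by auto
        have "(\<lambda>s. h s x) integrable_on k"
          using int_x sub unfolding k by (intro integrable_on_subcbox[OF int_x]) auto
        then have "((\<lambda>s. h t x - h s x) has_integral (measure lborel k * h t x - integral k (\<lambda>s. h s x))) (cbox b c)"
          unfolding k using has_integral_diff[OF has_integral_const[of "h t x" b c] integrable_integral]
          by (simp add: k)
        then have "norm (measure lborel k * h t x - integral k (\<lambda>s. h s x)) \<le> e' * measure lborel (cbox b c)"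
        proof (rule has_integral_bound[rotated])
          fix s assume "s \<in> cbox b c"
          then have "s \<in> k" by (simp add: k)
          then have "\<bar>h t x - h s x\<bar> < e'"
            using close[of t s x] x sub t ball by (auto simp: subset_iff)
          then show "norm (h t x - h s x) \<le> e'" by simp
        qed (use e' in simp)
        then show "\<bar>measure lborel k * h t x - integral k (\<lambda>t. h t x)\<bar> \<le> e' * measure lborel k"
          by (simp add: k)
      qed
      also have "\<dots> = e' * (\<Sum>(t, k)\<in>D. measure lborel k)"
        by (simp add: case_prod_unfold sum_distrib_left)
      also have "(\<Sum>(t, k)\<in>D. measure lborel k) = v - u"
        using additive_content_tagged_division[OF D_cbox] uv by simp
      finally show ?thesis .
    qed
    moreover have "0 \<le> e' * (v - u)" using e' uv by simp
    ultimately have "norm (S - J) \<le> e' * (v - u)"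
      by (simp add: cfc_value_norm_le_iff)
    then have "norm (S - J) * K \<le> e' * (v - u) * K"
      using K(1) by (intro mult_right_mono) auto
    then have "norm (T (S - J)) \<le> e' * (v - u) * K"
      using K(2)[of "S - J"] by linarith
    then show "norm ((\<Sum>(x, k)\<in>D. measure lborel k *\<^sub>R f x) - T J) < e"
      unfolding TS using e'_e by (simp add: linear_diff[OF bounded_linear.linear[OF T]])
  qed
qed

section \<open>The scalar Beta integral and a primitive for the integrands\<close>

lemma Gamma_reflection_real:
  fixes x :: real
  shows "Gamma x * Gamma (1 - x) = pi / sin (pi * x)"
proof -
  have "1 - complex_of_real x = of_real (1 - x)"
    by simp
  moreover have "sin (complex_of_real pi * of_real x) = of_real (sin (pi * x))"
    by (metis of_real_mult sin_of_real)
  ultimately have "complex_of_real (Gamma x * Gamma (1 - x)) = of_real (pi / sin (pi * x))"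
    using Gamma_reflection_complex[of "of_real x"]
    by (simp only: Gamma_complex_of_real of_real_mult of_real_divide)
  then show ?thesis
    by (simp only: of_real_eq_iff)
qed

definition incomplete_beta :: "real \<Rightarrow> real \<Rightarrow> real" where
  "incomplete_beta l y = integral {0..y} (\<lambda>s. s powr (l - 1) * (1 - s) powr (- l))"

lemma has_integral_beta:
  assumes "0 < l" "l < 1"
  shows "((\<lambda>s. s powr (l - 1) * (1 - s) powr (- l)) has_integral pi / sin (l * pi)) {0..1}"
  using has_integral_Beta_real[of l "1 - l"] assms Gamma_reflection_real[of l]
  by (simp add: Beta_def mult.commute)

lemma incomplete_beta_0 [simp]: "incomplete_beta l 0 = 0"
  by (simp add: incomplete_beta_def)

lemma incomplete_beta_1:
  assumes "0 < l" "l < 1"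
  shows "incomplete_beta l 1 = pi / sin (l * pi)"
  unfolding incomplete_beta_def using has_integral_beta[OF assms] by (rule integral_unique)

text \<open>Continuity at the end points 0 and 1, where the integrand is singular, is what later
  yields the two improper limits.\<close>

lemma continuous_on_incomplete_beta:
  assumes "0 < l" "l < 1"
  shows "continuous_on {0..1} (incomplete_beta l)"
  unfolding incomplete_beta_def
  using has_integral_beta[OF assms] by (intro indefinite_integral_continuous_1) (rule has_integral_integrable)

lemma incomplete_beta_derivative:
  assumes l: "0 < l" "l < 1" and y: "0 < y" "y < 1"
  shows "(incomplete_beta l has_real_derivative y powr (l - 1) * (1 - y) powr (- l)) (at y)"
proof -
  have "continuous (at y) (\<lambda>s. s powr (l - 1) * (1 - s) powr (- l))"
    using y by (intro continuous_intros) auto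
  then have "((\<lambda>u. integral {0..u} (\<lambda>s. s powr (l - 1) * (1 - s) powr (- l)))
      has_vector_derivative y powr (l - 1) * (1 - y) powr (- l)) (at y within {0..1} - {})"
    using y has_integral_beta[OF l]
    by (intro integral_has_vector_derivative_continuous_at)
      (auto intro: has_integral_integrable continuous_at_imp_continuous_at_within)
  then show ?thesis
    using y unfolding incomplete_beta_def
    by (simp add: at_within_Icc_at has_real_derivative_iff_has_vector_derivative)
qed

text \<open>The primitive in t of t^(l-1) x / (x + t) that tends to 0 as t does. All dependence on x
  beyond the factor x^l sits in the argument t / (x + t), so limits in t can be taken uniformly in
  x.\<close>

definition power_primitive :: "real \<Rightarrow> real \<Rightarrow> real \<Rightarrow> real" where
  "power_primitive l t x = x powr l * incomplete_beta l (t / (x + t))"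

lemma continuous_on_power_primitive:
  assumes "0 < l" "l < 1" "0 < t" "S \<subseteq> {0<..}"
  shows "continuous_on S (power_primitive l t)"
  unfolding power_primitive_def
proof (intro continuous_on_mult)
  show "continuous_on S (\<lambda>x. x powr l)"
    using assms by (intro continuous_intros) auto
  have "continuous_on S (\<lambda>x. t / (x + t))"
    using assms by (intro continuous_intros) force
  moreover have "(\<lambda>x. t / (x + t)) ` S \<subseteq> {0..1}"
    using assms by (force simp: divide_simps)
  ultimately show "continuous_on S (\<lambda>x. incomplete_beta l (t / (x + t)))"
    by (rule continuous_on_compose2[OF continuous_on_incomplete_beta[OF assms(1,2)]])
qed

lemma power_primitive_derivative:
  assumes l: "0 < l" "l < 1" and "0 < t" "0 < x"
  shows "((\<lambda>t. power_primitive l t x) has_real_derivative t powr (l - 1) * (x / (x + t))) (at t)"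
proof -
  define y where "y = t / (x + t)"
  have y: "0 < y" "y < 1" "1 - y = x / (x + t)"
    using assms by (simp_all add: y_def field_simps)
  have "((\<lambda>t. t / (x + t)) has_real_derivative x / (x + t)\<^sup>2) (at t)"
    using assms by (auto intro!: derivative_eq_intros simp: power2_eq_square)
  then have "((\<lambda>t. incomplete_beta l (t / (x + t))) has_real_derivative
      (y powr (l - 1) * (1 - y) powr (- l)) * (x / (x + t)\<^sup>2)) (at t)"
    using DERIV_chain2[of "incomplete_beta l" _ "\<lambda>t. t / (x + t)"] incomplete_beta_derivative[OF l y(1,2)]
    unfolding y_def by blast
  then have "((\<lambda>t. power_primitive l t x) has_real_derivative
      x powr l * ((y powr (l - 1) * (1 - y) powr (- l)) * (x / (x + t)\<^sup>2))) (at t)"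
    unfolding power_primitive_def by (rule DERIV_cmult)
  moreover have "x powr l * ((y powr (l - 1) * (1 - y) powr (- l)) * (x / (x + t)\<^sup>2)) = t powr (l - 1) * (x / (x + t))"
  proof -
    have "y powr (l - 1) = t powr (l - 1) * (x + t) / (x + t) powr l"
      using assms by (simp add: y_def powr_divide powr_diff)
    moreover have "(1 - y) powr (- l) = (x + t) powr l / x powr l"
      using assms by (simp add: y(3) powr_divide powr_minus_divide)
    ultimately show ?thesis
      using assms by (simp add: power2_eq_square)
  qed
  ultimately show ?thesis by simp
qed

lemma has_integral_power_primitive_inf:
  assumes l: "0 < l" "l < 1" and uv: "0 < u" "u \<le> v" and x: "0 < x"
  shows "((\<lambda>t. t powr (l - 1) * (x / (x + t))) has_integral (power_primitive l v x - power_primitive l u x)) {u..v}"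
  by (rule fundamental_theorem_of_calculus[OF uv(2)])
    (use power_primitive_derivative[OF l _ x] uv in
      \<open>auto simp flip: has_real_derivative_iff_has_vector_derivative intro: has_field_derivative_at_within\<close>)

text \<open>The substitution t = s / (1 - s) carries this integrand into the one on the half line;
  sharing the primitive makes the two improper integrals agree.\<close>

lemma has_integral_power_primitive_1:
  assumes l: "0 < l" "l < 1" and uv: "0 < u" "u \<le> v" "v < 1" and x: "0 < x"
  shows "((\<lambda>s. s powr (l - 1) / (1 - s) powr l * (x / ((1 - s) * x + s))) has_integral
    (power_primitive l (v / (1 - v)) x - power_primitive l (u / (1 - u)) x)) {u..v}"
proof (rule fundamental_theorem_of_calculus[OF uv(2)])
  fix s assume "s \<in> {u..v}"
  then have s: "0 < s" "s < 1" using uv by auto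
  define t where "t = s / (1 - s)"
  have t: "0 < t" using s by (simp add: t_def)
  have "((\<lambda>s. s / (1 - s)) has_real_derivative 1 / (1 - s)\<^sup>2) (at s)"
    using s by (auto intro!: derivative_eq_intros simp: power2_eq_square)
  then have "((\<lambda>s. power_primitive l (s / (1 - s)) x) has_real_derivative
      (t powr (l - 1) * (x / (x + t))) * (1 / (1 - s)\<^sup>2)) (at s)"
    using DERIV_chain2[of "\<lambda>t. power_primitive l t x" _ "\<lambda>s. s / (1 - s)"]
      power_primitive_derivative[OF l t x] unfolding t_def by blast
  moreover have "(t powr (l - 1) * (x / (x + t))) * (1 / (1 - s)\<^sup>2)
      = s powr (l - 1) / (1 - s) powr l * (x / ((1 - s) * x + s))"
  proof -
    have "t powr (l - 1) = s powr (l - 1) * (1 - s) / (1 - s) powr l"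
      using s by (simp add: t_def powr_divide powr_diff)
    moreover have "x / (x + t) = x * (1 - s) / ((1 - s) * x + s)"
      using s x by (simp add: t_def divide_simps) (simp add: algebra_simps)
    ultimately show ?thesis
      using s by (simp add: power2_eq_square)
  qed
  ultimately show "((\<lambda>s. power_primitive l (s / (1 - s)) x) has_vector_derivative
      s powr (l - 1) / (1 - s) powr l * (x / ((1 - s) * x + s))) (at s within {u..v})"
    by (simp flip: has_real_derivative_iff_has_vector_derivative add: has_field_derivative_at_within)
qed

lemma cfc_value_power_primitive:
  assumes C: "jpositive C" "jinvertible C" and "0 < l" "l < 1" "0 < t"
  shows "cfc_value C (power_primitive l t) (jcfc (power_primitive l t) C)"
  using assms jspectrum_pos[OF C] by (intro cfc_value_jcfc continuous_on_power_primitive) auto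

text \<open>Norm convergence is uniform convergence on the spectrum, which lies in
  [\<alpha>, \<beta>] with \<alpha> > 0. There y = t / (x + t) satisfies y \<le> t / \<alpha> and 1
  - y \<le> \<beta> / t, so continuity of the incomplete Beta function at 0 and at 1
  suffices.\<close>

lemma power_primitive_limits:
  assumes C: "jpositive C" "jinvertible C" and l: "0 < l" "l < 1"
  shows "((\<lambda>t. jcfc (power_primitive l t) C) \<longlongrightarrow> 0) (at_right 0)"
    and "((\<lambda>t. jcfc (power_primitive l t) C) \<longlongrightarrow> (pi / sin (l * pi)) *\<^sub>R jpowr C l) at_top"
proof -
  \<comment> \<open>The added 1 keeps \<beta> positive even in the zero algebra.\<close>
  define \<beta> where "\<beta> = norm C + 1"
  have \<beta>: "0 < \<beta>" by (simp add: \<beta>_def add_nonneg_pos)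
  obtain \<alpha> where \<alpha>: "0 < \<alpha>" "\<And>x. x \<in> jspectrum C \<Longrightarrow> \<alpha> \<le> x"
    using jspectrum_lower_bound[OF C] by blast
  have bounds: "0 < x" "\<alpha> \<le> x" "x \<le> \<beta>" "x powr l \<le> \<beta> powr l" if "x \<in> jspectrum C" for x
    using \<alpha> \<alpha>(2)[OF that] jspectrum_bound[OF that] l
    by (auto simp: \<beta>_def intro!: powr_mono2)
  define c where "c = pi / sin (l * pi)"
  define P where "P t = jcfc (power_primitive l t) C" for t
  have P: "cfc_value C (power_primitive l t) (P t)" if "0 < t" for t
    unfolding P_def by (rule cfc_value_power_primitive[OF C l that])
  \<comment> \<open>The factor x^l is at most \<beta>^l on the spectrum and is absorbed here once;
    the uses are y0 = 0 and y0 = 1.\<close>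
  have near: "\<exists>\<delta>>0. \<forall>y\<in>{0..1}. \<bar>y - y0\<bar> < \<delta> \<longrightarrow> \<bar>incomplete_beta l y - incomplete_beta l y0\<bar> * \<beta> powr l \<le> e"
    if "0 < e" and y0: "y0 \<in> {0..1}" for e y0
  proof -
    have "0 < e / \<beta> powr l" using \<open>0 < e\<close> \<beta> by simp
    then obtain \<delta> where \<delta>: "0 < \<delta>" "\<And>y. y \<in> {0..1} \<Longrightarrow> dist y y0 < \<delta> \<Longrightarrow>
        dist (incomplete_beta l y) (incomplete_beta l y0) < e / \<beta> powr l"
      using continuous_on_incomplete_beta[OF l] y0 unfolding continuous_on_iff by metis
    have "\<bar>incomplete_beta l y - incomplete_beta l y0\<bar> * \<beta> powr l \<le> e"
      if "y \<in> {0..1}" "\<bar>y - y0\<bar> < \<delta>" for y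
      using \<delta>(2)[OF that(1)] that(2) \<beta> by (simp add: dist_real_def field_simps)
    then show ?thesis using \<delta>(1) by blast
  qed
  have scaled: "\<bar>x powr l * r\<bar> \<le> \<bar>r\<bar> * \<beta> powr l" if "x \<in> jspectrum C" for x r
    using bounds(4)[OF that] by (simp add: abs_mult mult.commute[of "x powr l"] mult_left_mono)
  show "((\<lambda>t. jcfc (power_primitive l t) C) \<longlongrightarrow> 0) (at_right 0)"
    unfolding P_def[symmetric]
  proof (rule tendstoI)
    fix e :: real assume "0 < e"
    obtain \<delta> where \<delta>: "0 < \<delta>" "\<And>y. y \<in> {0..1} \<Longrightarrow> \<bar>y\<bar> < \<delta> \<Longrightarrow> \<bar>incomplete_beta l y\<bar> * \<beta> powr l \<le> e / 2"
      using near[of "e/2" 0] \<open>0 < e\<close> by auto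
    have "eventually (\<lambda>t. t \<in> {0<..<\<alpha> * \<delta>}) (at_right 0)"
      using \<alpha> \<delta> by (intro eventually_at_right_real) simp
    then show "eventually (\<lambda>t. dist (P t) 0 < e) (at_right 0)"
    proof eventually_elim
      case (elim t)
      have "\<bar>power_primitive l t x\<bar> \<le> e / 2" if x: "x \<in> jspectrum C" for x
      proof -
        have "t / (x + t) \<le> t / \<alpha>"
          using elim bounds[OF x] \<alpha> by (intro divide_left_mono) auto
        also have "\<dots> < \<delta>" using elim \<alpha> by (simp add: field_simps)
        finally have "\<bar>incomplete_beta l (t / (x + t))\<bar> * \<beta> powr l \<le> e / 2"
          using elim bounds[OF x] by (intro \<delta>(2)) (auto simp: divide_simps)
        then show ?thesis
          using scaled[OF x, of "incomplete_beta l (t / (x + t))"] by (simp add: power_primitive_def)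
      qed
      then have "norm (P t) \<le> e / 2"
        using cfc_value_norm_le_iff[OF P, of t "e/2"] elim \<open>0 < e\<close> by simp
      then show ?case using \<open>0 < e\<close> by simp
    qed
  qed
  show "((\<lambda>t. jcfc (power_primitive l t) C) \<longlongrightarrow> (pi / sin (l * pi)) *\<^sub>R jpowr C l) at_top"
    unfolding P_def[symmetric] c_def[symmetric]
  proof (rule tendstoI)
    fix e :: real assume "0 < e"
    obtain \<delta> where \<delta>: "0 < \<delta>" "\<And>y. y \<in> {0..1} \<Longrightarrow> \<bar>y - 1\<bar> < \<delta> \<Longrightarrow> \<bar>incomplete_beta l y - c\<bar> * \<beta> powr l \<le> e / 2"
      using near[of "e/2" 1] \<open>0 < e\<close> incomplete_beta_1[OF l] by (auto simp: c_def)
    show "eventually (\<lambda>t. dist (P t) (c *\<^sub>R jpowr C l) < e) at_top"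
      using eventually_gt_at_top[of 0] eventually_gt_at_top[of "\<beta> / \<delta>"]
    proof eventually_elim
      case (elim t)
      have "\<bar>power_primitive l t x - c * x powr l\<bar> \<le> e / 2" if x: "x \<in> jspectrum C" for x
      proof -
        have "1 - t / (x + t) = x / (x + t)" using elim bounds[OF x] by (simp add: field_simps)
        also have "\<dots> \<le> \<beta> / t"
          using elim bounds[OF x] \<beta> by (intro frac_le) auto
        also have "\<dots> < \<delta>" using elim \<delta> by (simp add: field_simps)
        finally have "\<bar>incomplete_beta l (t / (x + t)) - c\<bar> * \<beta> powr l \<le> e / 2"
          using elim bounds[OF x] by (intro \<delta>(2)) (auto simp: divide_simps)
        then show ?thesis
          using scaled[OF x, of "incomplete_beta l (t / (x + t)) - c"]
          by (simp add: power_primitive_def right_diff_distrib mult.commute)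
      qed
      moreover have "cfc_value C (\<lambda>x. power_primitive l t x - c * x powr l) (P t - c *\<^sub>R jpowr C l)"
        using elim by (intro cfc_value_diff P cfc_value_scaleR cfc_value_jpowr C)
      ultimately have "norm (P t - c *\<^sub>R jpowr C l) \<le> e / 2"
        using cfc_value_norm_le_iff[of C "\<lambda>x. power_primitive l t x - c * x powr l" _ "e/2"] \<open>0 < e\<close> by simp
      then show ?case using \<open>0 < e\<close> by (simp add: dist_norm)
    qed
  qed
qed

section \<open>The two improper integrals\<close>

lemma cfc_value_weighted_inverse:
  fixes A B :: "'a::unital_jb_algebra"
  assumes A: "jpositive A" "jinvertible A" and B: "jpositive B" "jinvertible B"
    and weights: "0 \<le> \<alpha>" "0 < \<beta>"
  shows "\<exists>y. cfc_value (jtriple (jpowr A (- 1/2)) B) (\<lambda>x. k * (x / (\<alpha> * x + \<beta>))) y \<and>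
    k *\<^sub>R jinv (\<alpha> *\<^sub>R jinv A + \<beta> *\<^sub>R jinv B) = jtriple (jpowr A (1/2)) y"
proof -
  define C where "C = jtriple (jpowr A (- 1/2)) B"
  have C: "jpositive C" "jinvertible C"
    unfolding C_def by (rule jpositive_jtriple[OF jpowr_half_is_jinverse(2)[OF A] B])+
  have "\<alpha> * x + \<beta> \<noteq> 0" if "x \<in> jspectrum C" for x
    using mult_nonneg_nonneg[OF weights(1) less_imp_le[OF jspectrum_pos[OF C that]]] weights(2) by linarith
  then have "continuous_on (jspectrum C) (\<lambda>x. x / (\<alpha> * x + \<beta>))"
    by (simp add: continuous_on_divide continuous_on_add continuous_on_mult_left)
  then obtain y where y: "cfc_value C (\<lambda>x. x / (\<alpha> * x + \<beta>)) y"
    by (rule cfc_value_exists)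
  have "jinv (\<alpha> *\<^sub>R jinv A + \<beta> *\<^sub>R jinv B) = jtriple (jpowr A (1/2)) y"
    using weights by (intro weighted_inverse_sum[OF A B] y[unfolded C_def]) auto
  then have "k *\<^sub>R jinv (\<alpha> *\<^sub>R jinv A + \<beta> *\<^sub>R jinv B) = jtriple (jpowr A (1/2)) (k *\<^sub>R y)"
    by (simp add: linear_scale[OF jtriple_linear])
  then show ?thesis
    using cfc_value_scaleR[OF y] unfolding C_def by blast
qed

lemma has_integral_0_inf_cfc:
  assumes C: "jpositive C" "jinvertible C" and l: "0 < l" "l < 1" and T: "bounded_linear T"
    and f: "\<And>t. 0 < t \<Longrightarrow> \<exists>y. cfc_value C (\<lambda>x. t powr (l - 1) * (x / (x + t))) y \<and> f t = T y"
  shows "has_integral_0_inf f (T ((pi / sin (l * pi)) *\<^sub>R jpowr C l))"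
proof -
  define P where "P t = jcfc (power_primitive l t) C" for t
  define Y where "Y = T ((pi / sin (l * pi)) *\<^sub>R jpowr C l)"
  have P: "cfc_value C (power_primitive l t) (P t)" if "0 < t" for t
    unfolding P_def by (rule cfc_value_power_primitive[OF C l that])
  have 0: "((\<lambda>t. T (P t)) \<longlongrightarrow> 0) (at_right 0)"
    using bounded_linear.tendsto[OF T power_primitive_limits(1)[OF C l]]
    by (simp add: P_def linear_0[OF bounded_linear.linear[OF T]])
  have inf: "((\<lambda>t. T (P t)) \<longlongrightarrow> Y) at_top"
    unfolding P_def Y_def by (rule bounded_linear.tendsto[OF T power_primitive_limits(2)[OF C l]])
  have "has_integral_0_inf f Y"
    unfolding has_integral_0_inf_def has_improper_integral_def
  proof (intro exI conjI ballI impI)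
    fix u v :: real assume uv: "u \<in> {0<..}" "v \<in> {0<..}" "u \<le> v"
    \<comment> \<open>This goal fixes the existential family as
      \<open>J u v = T (P v - P u)\<close>.\<close>
    show "has_riemann_integral f (T (P v - P u)) u v"
    proof (rule has_riemann_integral_cfc[OF T uv(3)])
      show "cfc_value C (\<lambda>x. power_primitive l v x - power_primitive l u x) (P v - P u)"
        using uv by (intro cfc_value_diff P) auto
      show "((\<lambda>t. t powr (l - 1) * (x / (x + t))) has_integral
          (power_primitive l v x - power_primitive l u x)) {u..v}" if "x \<in> jspectrum C" for x
        using has_integral_power_primitive_inf[OF l, of u v x] uv jspectrum_pos[OF C that] by simp
      have "x + t \<noteq> 0" if "t \<in> {u..v}" "x \<in> jspectrum C" for t x
        using jspectrum_pos[OF C that(2)] that(1) uv by simp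
      then show "continuous_on ({u..v} \<times> jspectrum C) (\<lambda>(t, x). t powr (l - 1) * (x / (x + t)))"
        using uv unfolding case_prod_unfold by (intro continuous_intros) auto
      show "\<exists>y. cfc_value C (\<lambda>x. t powr (l - 1) * (x / (x + t))) y \<and> f t = T y" if "t \<in> {u..v}" for t
        using that uv by (intro f) auto
    qed
  next
    \<comment> \<open>Each end point enters through its own term, so the limit along the product
      filter splits into two one-sided limits.\<close>
    have "((\<lambda>p. T (P (snd p)) - T (P (fst p))) \<longlongrightarrow> Y - 0) (at_right 0 \<times>\<^sub>F at_top)"
      by (intro tendsto_diff filterlim_compose[OF inf filterlim_snd] filterlim_compose[OF 0 filterlim_fst])
    then show "((\<lambda>(u, v). T (P v - P u)) \<longlongrightarrow> Y) (at_right 0 \<times>\<^sub>F at_top)"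
      by (simp add: case_prod_unfold linear_diff[OF bounded_linear.linear[OF T]])
  qed
  then show ?thesis by (simp add: Y_def)
qed

lemma has_integral_0_1_cfc:
  assumes C: "jpositive C" "jinvertible C" and l: "0 < l" "l < 1" and T: "bounded_linear T"
    and f: "\<And>t. 0 < t \<Longrightarrow> t < 1 \<Longrightarrow>
      \<exists>y. cfc_value C (\<lambda>x. t powr (l - 1) / (1 - t) powr l * (x / ((1 - t) * x + t))) y \<and> f t = T y"
  shows "has_integral_0_1 f (T ((pi / sin (l * pi)) *\<^sub>R jpowr C l))"
proof -
  define P where "P t = jcfc (power_primitive l (t / (1 - t))) C" for t
  define Y where "Y = T ((pi / sin (l * pi)) *\<^sub>R jpowr C l)"
  have P: "cfc_value C (power_primitive l (t / (1 - t))) (P t)" if "0 < t" "t < 1" for t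
    unfolding P_def using that by (intro cfc_value_power_primitive C l) simp
  \<comment> \<open>The change of variable sends the ends 0 and 1 to 0 and infinity, so the earlier
    limits can be composed with it.\<close>
  have "filterlim (\<lambda>t::real. t / (1 - t)) (at_right 0) (at_right 0)"
    by real_asymp
  from bounded_linear.tendsto[OF T filterlim_compose[OF power_primitive_limits(1)[OF C l] this]]
  have 0: "((\<lambda>t. T (P t)) \<longlongrightarrow> 0) (at_right 0)"
    by (simp add: P_def linear_0[OF bounded_linear.linear[OF T]])
  have "filterlim (\<lambda>t::real. t / (1 - t)) at_top (at_left 1)"
    by real_asymp
  from bounded_linear.tendsto[OF T filterlim_compose[OF power_primitive_limits(2)[OF C l] this]]
  have 1: "((\<lambda>t. T (P t)) \<longlongrightarrow> Y) (at_left 1)"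
    by (simp add: P_def Y_def)
  have "has_integral_0_1 f Y"
    unfolding has_integral_0_1_def has_improper_integral_def
  proof (intro exI conjI ballI impI)
    fix u v :: real assume uv: "u \<in> {0<..<1}" "v \<in> {0<..<1}" "u \<le> v"
    show "has_riemann_integral f (T (P v - P u)) u v"
    proof (rule has_riemann_integral_cfc[OF T uv(3)])
      show "cfc_value C (\<lambda>x. power_primitive l (v / (1 - v)) x - power_primitive l (u / (1 - u)) x) (P v - P u)"
        using uv by (intro cfc_value_diff P) auto
      show "((\<lambda>t. t powr (l - 1) / (1 - t) powr l * (x / ((1 - t) * x + t))) has_integral
          (power_primitive l (v / (1 - v)) x - power_primitive l (u / (1 - u)) x)) {u..v}"
        if "x \<in> jspectrum C" for x
        using uv jspectrum_pos[OF C that] by (intro has_integral_power_primitive_1 l) auto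
      have "(1 - t) * x + t \<noteq> 0" if "t \<in> {u..v}" "x \<in> jspectrum C" for t x
      proof -
        have "0 < t" "0 \<le> (1 - t) * x"
          using jspectrum_pos[OF C that(2)] that(1) uv by (auto intro!: mult_nonneg_nonneg)
        then show ?thesis by linarith
      qed
      then show "continuous_on ({u..v} \<times> jspectrum C)
          (\<lambda>(t, x). t powr (l - 1) / (1 - t) powr l * (x / ((1 - t) * x + t)))"
        using uv unfolding case_prod_unfold by (intro continuous_intros) auto
      show "\<exists>y. cfc_value C (\<lambda>x. t powr (l - 1) / (1 - t) powr l * (x / ((1 - t) * x + t))) y \<and> f t = T y"
        if "t \<in> {u..v}" for t
        using that uv by (intro f) auto
    qed
  next
    have "((\<lambda>p. T (P (snd p)) - T (P (fst p))) \<longlongrightarrow> Y - 0) (at_right 0 \<times>\<^sub>F at_left 1)"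
      by (intro tendsto_diff filterlim_compose[OF 1 filterlim_snd] filterlim_compose[OF 0 filterlim_fst])
    then show "((\<lambda>(u, v). T (P v - P u)) \<longlongrightarrow> Y) (at_right 0 \<times>\<^sub>F at_left 1)"
      by (simp add: case_prod_unfold linear_diff[OF bounded_linear.linear[OF T]])
  qed
  then show ?thesis by (simp add: Y_def)
qed

theorem theorem2:
  fixes A B :: "'a::unital_jb_algebra" and l :: real
  assumes "jpositive A" "jinvertible A" "jpositive B" "jinvertible B"
    and "0 < l" "l < 1"
  shows "\<exists>J\<^sub>1 J\<^sub>2.
      has_integral_0_inf (\<lambda>t. t powr (l - 1) *\<^sub>R jinv (jinv A + t *\<^sub>R jinv B)) J\<^sub>1
    \<and> has_integral_0_1 (\<lambda>t. (t powr (l - 1) / (1 - t) powr l) *\<^sub>R harmonic_mean t A B) J\<^sub>2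
    \<and> geometric_mean l A B = (sin (l * pi) / pi) *\<^sub>R J\<^sub>1
    \<and> (sin (l * pi) / pi) *\<^sub>R J\<^sub>1 = (sin (l * pi) / pi) *\<^sub>R J\<^sub>2"
proof -
  note A = assms(1,2) and B = assms(3,4) and l = assms(5,6)
  define T where "T = jtriple (jpowr A (1/2))"
  define C where "C = jtriple (jpowr A (- 1/2)) B"
  define Y where "Y = T ((pi / sin (l * pi)) *\<^sub>R jpowr C l)"
  have C: "jpositive C" "jinvertible C"
    unfolding C_def by (rule jpositive_jtriple[OF jpowr_half_is_jinverse(2)[OF A] B])+
  note mean = cfc_value_weighted_inverse[OF A B, folded T_def C_def]
  have T: "bounded_linear T"
    unfolding T_def by (rule bounded_linear_jtriple)
  \<comment> \<open>The weights are (1, t) here and (1 - t, t) for the harmonic mean; both integrals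
    have the value \<open>Y\<close>.\<close>
  have "has_integral_0_inf (\<lambda>t. t powr (l - 1) *\<^sub>R jinv (jinv A + t *\<^sub>R jinv B)) Y"
    unfolding Y_def using mean[of 1] by (intro has_integral_0_inf_cfc C l T) simp
  moreover have "has_integral_0_1 (\<lambda>t. (t powr (l - 1) / (1 - t) powr l) *\<^sub>R harmonic_mean t A B) Y"
    unfolding Y_def harmonic_mean_def by (intro has_integral_0_1_cfc C l T mean) auto
  \<comment> \<open>Needed to cancel the Beta constant pi / sin (l pi) carried by \<open>Y\<close>
    against the prefactor.\<close>
  moreover have "0 < sin (l * pi)"
    using l by (intro sin_gt_zero) auto
  then have "geometric_mean l A B = (sin (l * pi) / pi) *\<^sub>R Y"
    by (simp add: Y_def T_def C_def geometric_mean_def linear_scale[OF jtriple_linear])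
  ultimately show ?thesis by blast
qed

end
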